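(* Assume $(S-1)\alpha\in\ell^2$. Then $$\int_0^{2\pi}(1-\cos3\theta)\log w(\theta)\frac{d\theta}{2\pi}>-\infty\iff\alpha\in\ell^4.$$
   Context: $\mu$ is a probability measure with infinite support on the unit circle (identified with $[0,2\pi]$ via $e^{i\theta}\mapsto\theta$), with Lebesgue decomposition $d\mu(\theta)=w(\theta)\frac{d\theta}{2\pi}+d\mu_s(\theta)$. $\Phi_n$ are its monic orthogonal polynomials, and its sequence of Verblunsky coefficients is $\alpha=(\alpha_n)_{n\ge0}$, $\alpha_n=-\overline{\Phi_{n+1}(0)}\in\mathbb{D}$. $S$ is the left shift on sequences, $(S\alpha)_n=\alpha_{n+1}$. The integral is well defined in $[-\infty,\infty)$. *)

theory Defs
  imports "HOL-Probability.Probability" "HOL-Computational_Algebra.Polynomial"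
begin

section \<open>Measures on the unit circle\<close>

definition circle_borel :: "complex measure" where
  "circle_borel = restrict_space borel (sphere 0 1)"

definition measure_support :: "'a::topological_space measure \<Rightarrow> 'a set" where
  "measure_support \<mu> = {z \<in> space \<mu>. \<forall>U. open U \<longrightarrow> z \<in> U \<longrightarrow> emeasure \<mu> (U \<inter> space \<mu>) > 0}"

definition nontrivial_circle_prob :: "complex measure \<Rightarrow> bool" where
  "nontrivial_circle_prob \<mu> \<longleftrightarrow>
     prob_space \<mu> \<and> sets \<mu> = sets circle_borel \<and> infinite (measure_support \<mu>)"

text \<open>
  The measure \<open>d\<theta>/2\<pi>\<close> on \<open>[0, 2\<pi>]\<close>. Its underlying space is the whole real line, of which the
  complement of \<open>[0, 2\<pi>]\<close> is a null set. Pushing it forward along \<^term>\<open>cis\<close> gives the normalized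
  arc length; the two endpoints have the same image, but they are null.
\<close>
definition angle_measure :: "real measure" where
  "angle_measure = uniform_measure lborel {0..2 * pi}"

definition arc_length :: "complex measure" where
  "arc_length = distr angle_measure circle_borel cis"

definition mutually_singular :: "'a measure \<Rightarrow> 'a measure \<Rightarrow> bool" where
  "mutually_singular M N \<longleftrightarrow>
     (\<exists>A. A \<in> sets M \<and> A \<in> sets N \<and> emeasure M A = 0 \<and> emeasure N (space N - A) = 0)"

text \<open>\<open>d\<mu> = w(\<theta>) d\<theta>/2\<pi> + d\<mu>\<^sub>s\<close>; this determines \<open>\<mu>\<^sub>s\<close>, and \<open>w\<close> almost everywhere on \<open>[0, 2\<pi>]\<close>.\<close>
definition lebesgue_decomposition ::
    "complex measure \<Rightarrow> (real \<Rightarrow> real) \<Rightarrow> complex measure \<Rightarrow> bool" where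
  "lebesgue_decomposition \<mu> w \<mu>s \<longleftrightarrow>
     w \<in> borel_measurable borel \<and> (\<forall>\<theta>\<in>{0..2 * pi}. 0 \<le> w \<theta>) \<and>
     sets \<mu>s = sets circle_borel \<and> mutually_singular \<mu>s arc_length \<and>
     (\<forall>A\<in>sets circle_borel.
        emeasure \<mu> A =
          emeasure (distr (density angle_measure (\<lambda>\<theta>. ennreal (w \<theta>))) circle_borel cis) A
          + emeasure \<mu>s A)"

section \<open>Monic orthogonal polynomials and Verblunsky coefficients\<close>

definition L2_inner :: "complex measure \<Rightarrow> complex poly \<Rightarrow> complex poly \<Rightarrow> complex" where
  "L2_inner \<mu> p q = (\<integral>z. cnj (poly p z) * poly q z \<partial>\<mu>)"

definition is_monic_OP :: "complex measure \<Rightarrow> nat \<Rightarrow> complex poly \<Rightarrow> bool" where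
  "is_monic_OP \<mu> n p \<longleftrightarrow>
     degree p = n \<and> lead_coeff p = 1 \<and> (\<forall>k<n. L2_inner \<mu> (monom 1 k) p = 0)"

text \<open>Existence and uniqueness for nontrivial measures is lemma \<open>is_monic_OP_ex1\<close> below.\<close>
definition monic_OP :: "complex measure \<Rightarrow> nat \<Rightarrow> complex poly" where
  "monic_OP \<mu> n = (THE p. is_monic_OP \<mu> n p)"

definition verblunsky :: "complex measure \<Rightarrow> nat \<Rightarrow> complex" where
  "verblunsky \<mu> n = - cnj (poly (monic_OP \<mu> (Suc n)) 0)"

section \<open>Sequences\<close>

definition left_shift :: "(nat \<Rightarrow> 'a) \<Rightarrow> nat \<Rightarrow> 'a" where
  "left_shift a n = a (Suc n)"

definition ell :: "nat \<Rightarrow> (nat \<Rightarrow> complex) set" where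
  "ell p = {a. summable (\<lambda>n. norm (a n) ^ p)}"

section \<open>Integrals with values in the extended reals\<close>

text \<open>In the library \<^term>\<open>ln (0::real)\<close> is \<open>0\<close>, whereas here \<open>log 0 = -\<infinity>\<close> is needed.\<close>
definition elog :: "real \<Rightarrow> ereal" where
  "elog x = (if x \<le> 0 then - \<infinity> else ereal (ln x))"

text \<open>
  The difference of the integrals of the positive and the negative part
  (\<^const>\<open>e2ennreal\<close> maps negative numbers to \<open>0\<close>). It is meaningful if one of the two is finite.
  In the integral below the integral of the positive part is finite when \<open>w\<close> is integrable,
  since \<open>log w \<le> w\<close>.
\<close>
definition ereal_integral :: "'a measure \<Rightarrow> ('a \<Rightarrow> ereal) \<Rightarrow> ereal" where
  "ereal_integral M f =
     enn2ereal (\<integral>\<^sup>+x. e2ennreal (f x) \<partial>M) - enn2ereal (\<integral>\<^sup>+x. e2ennreal (- f x) \<partial>M)"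

definition szego_integral :: "(real \<Rightarrow> real) \<Rightarrow> ereal" where
  "szego_integral w = ereal_integral angle_measure (\<lambda>\<theta>. ereal (1 - cos (3 * \<theta>)) * elog (w \<theta>))"

section \<open>Well-definedness of the monic orthogonal polynomials\<close>

lemma nontrivial_circle_probD:
  assumes "nontrivial_circle_prob \<mu>"
  shows "prob_space \<mu>" "sets \<mu> = sets circle_borel" "space \<mu> = sphere 0 1"
    "infinite (measure_support \<mu>)"
  using assms sets_eq_imp_space_eq[of \<mu> circle_borel]
  by (auto simp: nontrivial_circle_prob_def circle_borel_def space_restrict_space)

lemma continuous_imp_measurable_circle:
  assumes "nontrivial_circle_prob \<mu>" and "continuous_on UNIV (f :: complex \<Rightarrow> 'b::topological_space)"
  shows "f \<in> borel_measurable \<mu>"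
proof -
  have "f \<in> borel_measurable circle_borel"
    unfolding circle_borel_def
    by (intro measurable_restrict_space1 borel_measurable_continuous_onI assms)
  then show ?thesis
    using measurable_cong_sets[OF nontrivial_circle_probD(2)[OF assms(1)] refl] by blast
qed

lemma continuous_imp_integrable_circle:
  fixes f :: "complex \<Rightarrow> complex"
  assumes mu: "nontrivial_circle_prob \<mu>" and f: "continuous_on UNIV f"
  shows "integrable \<mu> f"
proof -
  interpret prob_space \<mu> using nontrivial_circle_probD(1)[OF mu] .
  have "compact (f ` sphere 0 1)"
    by (intro compact_continuous_image continuous_on_subset[OF f]) auto
  then obtain B where "\<And>z. z \<in> sphere 0 1 \<Longrightarrow> norm (f z) \<le> B"
    using compact_imp_bounded bounded_iff by (metis imageI)
  then show ?thesis
    using continuous_imp_measurable_circle[OF mu f] nontrivial_circle_probD(3)[OF mu]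
    by (intro integrable_const_bound[where B = B]) auto
qed

lemma L2_integrable:
  assumes "nontrivial_circle_prob \<mu>"
  shows "integrable \<mu> (\<lambda>z. cnj (poly p z) * poly q z)"
  by (intro continuous_imp_integrable_circle assms continuous_intros)

lemma L2_inner_linear:
  assumes "nontrivial_circle_prob \<mu>"
  shows "L2_inner \<mu> p (q + r) = L2_inner \<mu> p q + L2_inner \<mu> p r"
    "L2_inner \<mu> p (q - r) = L2_inner \<mu> p q - L2_inner \<mu> p r"
    "L2_inner \<mu> p (smult c q) = c * L2_inner \<mu> p q"
    "L2_inner \<mu> (q + r) p = L2_inner \<mu> q p + L2_inner \<mu> r p"
    "L2_inner \<mu> (q - r) p = L2_inner \<mu> q p - L2_inner \<mu> r p"
    "L2_inner \<mu> (smult c q) p = cnj c * L2_inner \<mu> q p"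
proof -
  note [simp] = L2_integrable[OF assms]
  show "L2_inner \<mu> p (q + r) = L2_inner \<mu> p q + L2_inner \<mu> p r"
    "L2_inner \<mu> p (q - r) = L2_inner \<mu> p q - L2_inner \<mu> p r"
    "L2_inner \<mu> (q + r) p = L2_inner \<mu> q p + L2_inner \<mu> r p"
    "L2_inner \<mu> (q - r) p = L2_inner \<mu> q p - L2_inner \<mu> r p"
    by (simp_all add: L2_inner_def ring_distribs)
  show "L2_inner \<mu> p (smult c q) = c * L2_inner \<mu> p q"
    using integral_mult_right_zero[of \<mu> c "\<lambda>z. cnj (poly p z) * poly q z"]
    by (simp add: L2_inner_def mult.left_commute)
  show "L2_inner \<mu> (smult c q) p = cnj c * L2_inner \<mu> q p"
    using integral_mult_right_zero[of \<mu> "cnj c" "\<lambda>z. cnj (poly q z) * poly p z"]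
    by (simp add: L2_inner_def mult.assoc)
qed

lemma L2_inner_eq_0_imp:
  assumes mu: "nontrivial_circle_prob \<mu>" and "L2_inner \<mu> p p = 0"
  shows "p = 0"
proof (rule ccontr)
  assume "p \<noteq> 0"
  interpret prob_space \<mu> using nontrivial_circle_probD(1)[OF mu] .
  let ?f = "\<lambda>z. (norm (poly p z))\<^sup>2"
  have eq: "cnj (poly p z) * poly p z = of_real (?f z)" for z
    using complex_norm_square[of "poly p z"] by (simp add: mult.commute)
  have "integrable \<mu> (\<lambda>z. complex_of_real (?f z))"
    using L2_integrable[OF mu, of p p] by (simp only: eq)
  then have int: "integrable \<mu> ?f"
    by (simp only: complex_of_real_integrable_eq)
  have "(\<integral>z. ?f z \<partial>\<mu>) = 0"
    using assms(2) by (simp only: L2_inner_def eq integral_complex_of_real of_real_eq_0_iff)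
  then have "AE z in \<mu>. ?f z = 0"
    using integral_nonneg_eq_0_iff_AE[OF int] by simp
  then have ae: "AE z in \<mu>. poly p z = 0" by simp
  have "measure_support \<mu> \<subseteq> {z. poly p z = 0}"
  proof
    fix z assume z: "z \<in> measure_support \<mu>"
    show "z \<in> {z. poly p z = 0}"
    proof (rule ccontr)
      assume nz: "z \<notin> {z. poly p z = 0}"
      let ?U = "{z. poly p z \<noteq> 0}"
      have "open ?U" by (intro open_Collect_neq continuous_intros)
      with z nz have "emeasure \<mu> (?U \<inter> space \<mu>) > 0"
        by (auto simp: measure_support_def)
      moreover have "emeasure \<mu> (?U \<inter> space \<mu>) = 0"
      proof -
        have [measurable]: "poly p \<in> borel_measurable \<mu>"
          by (intro continuous_imp_measurable_circle[OF mu] continuous_intros)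
        have "{z \<in> space \<mu>. poly p z \<noteq> 0} \<in> sets \<mu>"
          by measurable
        with ae have "emeasure \<mu> {z \<in> space \<mu>. poly p z \<noteq> 0} = 0"
          by (subst (asm) AE_iff_measurable[OF _ refl]) auto
        then show ?thesis by (simp add: Int_def conj_commute)
      qed
      ultimately show False by simp
    qed
  qed
  then have "finite (measure_support \<mu>)"
    using poly_roots_finite[OF \<open>p \<noteq> 0\<close>] finite_subset by blast
  then show False using nontrivial_circle_probD(4)[OF mu] by simp
qed

lemma L2_inner_low_degree:
  assumes mu: "nontrivial_circle_prob \<mu>"
    and "\<forall>k\<ge>n. coeff q k = 0" and "\<forall>k<n. L2_inner \<mu> (monom 1 k) p = 0"
  shows "L2_inner \<mu> q p = 0"
  using assms(2,3)
proof (induction n arbitrary: q)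
  case 0
  then have "q = 0" by (simp add: poly_eq_iff)
  then show ?case by (simp add: L2_inner_def)
next
  case (Suc n)
  let ?r = "q - smult (coeff q n) (monom 1 n)"
  have "\<forall>k\<ge>n. coeff ?r k = 0"
    using Suc.prems(1) by (auto simp: not_less_eq_eq[symmetric] intro: le_antisym)
  then have "L2_inner \<mu> ?r p = 0"
    using Suc.IH Suc.prems(2) by (metis less_SucI)
  then show ?case
    using Suc.prems(2) by (simp only: L2_inner_linear[OF mu]) simp
qed

lemma L2_projection_ex:
  assumes mu: "nontrivial_circle_prob \<mu>"
  shows "\<exists>r. (\<forall>k\<ge>n. coeff r k = 0) \<and> (\<forall>k<n. L2_inner \<mu> (monom 1 k) (f - r) = 0)"
proof (induction n arbitrary: f)
  case 0
  show ?case by (rule exI[of _ 0]) simp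
next
  case (Suc n)
  obtain r where r: "\<forall>k\<ge>n. coeff r k = 0" "\<forall>k<n. L2_inner \<mu> (monom 1 k) (f - r) = 0"
    using Suc by blast
  obtain s where s: "\<forall>k\<ge>n. coeff s k = 0" "\<forall>k<n. L2_inner \<mu> (monom 1 k) (monom 1 n - s) = 0"
    using Suc by blast
  define e where "e = monom 1 n - s"
  have "coeff e n = 1" using s(1) by (simp add: e_def)
  then have "e \<noteq> 0" by auto
  then have ne: "L2_inner \<mu> e e \<noteq> 0" using L2_inner_eq_0_imp[OF mu] by blast
  have "L2_inner \<mu> s e = 0" using L2_inner_low_degree[OF mu s(1)] s(2) by (simp add: e_def)
  then have ee: "L2_inner \<mu> (monom 1 n) e = L2_inner \<mu> e e"
    using L2_inner_linear(5)[OF mu, of "monom 1 n" s e] by (simp add: e_def)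
  define c where "c = L2_inner \<mu> (monom 1 n) (f - r) / L2_inner \<mu> e e"
  have lin: "L2_inner \<mu> p (f - (r + smult c e)) = L2_inner \<mu> p (f - r) - c * L2_inner \<mu> p e" for p
    by (simp add: L2_inner_linear[OF mu])
  have "\<forall>k<Suc n. L2_inner \<mu> (monom 1 k) (f - (r + smult c e)) = 0"
    using r(2) s(2) ee ne unfolding lin by (auto simp: less_Suc_eq c_def simp flip: e_def)
  moreover have "\<forall>k\<ge>Suc n. coeff (r + smult c e) k = 0"
    using r(1) s(1) by (simp add: e_def)
  ultimately show ?case by blast
qed

lemma is_monic_OP_ex1:
  assumes mu: "nontrivial_circle_prob \<mu>"
  shows "\<exists>!p. is_monic_OP \<mu> n p"
proof -
  obtain r where r: "\<forall>k\<ge>n. coeff r k = 0" "\<forall>k<n. L2_inner \<mu> (monom 1 k) (monom 1 n - r) = 0"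
    using L2_projection_ex[OF mu] by blast
  have 1: "coeff (monom 1 n - r) n = 1" by (simp add: r(1))
  have "degree (monom 1 n - r) \<le> n" by (rule degree_le) (use r(1) in auto)
  moreover have "n \<le> degree (monom 1 n - r)" by (rule le_degree) (simp add: r(1))
  ultimately have "degree (monom 1 n - r) = n" by simp
  then have ex: "is_monic_OP \<mu> n (monom 1 n - r)"
    using 1 r(2) by (simp add: is_monic_OP_def)
  have "p = q" if p: "is_monic_OP \<mu> n p" and q: "is_monic_OP \<mu> n q" for p q
  proof -
    have "\<forall>k\<ge>n. coeff (p - q) k = 0"
      using p q by (auto simp: is_monic_OP_def le_eq_less_or_eq coeff_eq_0)
    moreover have "\<forall>k<n. L2_inner \<mu> (monom 1 k) (p - q) = 0"
      using p q by (simp add: is_monic_OP_def L2_inner_linear[OF mu])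
    ultimately have "L2_inner \<mu> (p - q) (p - q) = 0"
      using L2_inner_low_degree[OF mu] by blast
    then show ?thesis using L2_inner_eq_0_imp[OF mu] by fastforce
  qed
  with ex show ?thesis by blast
qed

end

theory Submission
  imports Defs "HOL-Complex_Analysis.Complex_Analysis"
begin

text \<open>
  Let \<open>Z\<^sub>n\<close> be the integral of \<open>1 - cos 3\<theta>\<close> against \<open>log w\<^sub>n\<close>, where \<open>w\<^sub>n = \<Prod>(1 - |\<alpha>\<^sub>j|\<^sup>2) / |\<Phi>\<^sub>n\<^sup>*|\<^sup>2\<close> is the
  \<open>n\<close>-th Bernstein-Szego weight. Since \<open>w\<^sub>n d\<theta>/2\<pi>\<close> has the same moments as \<open>\<mu>\<close> up to order \<open>n\<close>, it
  converges weakly to \<open>\<mu>\<close>, and \<open>log x \<le> x\<close> shows that the integral of the theorem is greater than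
  \<open>-\<infinity>\<close> iff \<open>Z\<^sub>n\<close> is bounded below: in one direction apply it to \<open>x = w / w\<^sub>n = w |\<phi>\<^sub>n|\<^sup>2\<close>, whose integral is
  at most \<open>1\<close>, in the other to \<open>x = f w\<^sub>n\<close> with continuous functions \<open>f\<close> approximating truncations of \<open>1 / w\<close>.
  By Cauchy's formula \<open>Z\<^sub>n\<close> is the sum of the \<open>log (1 - |\<alpha>\<^sub>j|\<^sup>2)\<close> plus the real part of the third Taylor
  coefficient of \<open>log \<Phi>\<^sub>n\<^sup>*\<close>. The Szego recursion gives \<open>Z\<^sub>n\<^sub>+\<^sub>1 - Z\<^sub>n\<close> explicitly in terms of four consecutive
  Verblunsky coefficients; modulo a telescoping sum and squares of differences it lies between two
  negative multiples of \<open>|\<alpha>\<^sub>n|\<^sup>4\<close> (the lower bound as soon as \<open>|\<alpha>\<^sub>n|\<^sup>2 \<le> 1/2\<close>).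
\<close>

section \<open>The Szego recursion\<close>

text \<open>The hypothesis makes only squares of differences summable. An error linear in a
  difference \<delta> is harmless if it carries a factor |\<alpha>|^2, since |\<alpha>|^2 \<delta>
  splits into multiples of |\<alpha>|^4 and \<delta>^2. The quadratic term
  \<open>\<alpha> (n + 3) * cnj (\<alpha> n)\<close> has no such factor to spare; it is treated
  exactly by polarization. Its real part is half of |\<alpha>|^2 at both indices, up to a squared
  difference; against the linear term of the logarithm this leaves half of a difference of
  |\<alpha>|^2 three indices apart, which telescopes. So the quartic order decides. No convergence
  of the \<open>Z\<close> sequence is claimed, only a lower bound, and for this the inequality for
  the logarithm replaces the general semicontinuity of relative entropy. The second direction has
  two obstacles: weak convergence tests only continuous functions whereas 1/w is merely Borel, and
  the singular part is invisible to w. Hence the truncation, and the approximation of one function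
  in two measures at once. The recursion is set up for arbitrary sequences, with the reversed
  polynomial as a second component; the measure enters only through uniqueness of the orthogonal
  polynomials.\<close>

fun szego_poly :: "(nat \<Rightarrow> complex) \<Rightarrow> nat \<Rightarrow> complex poly"
  and szego_rev :: "(nat \<Rightarrow> complex) \<Rightarrow> nat \<Rightarrow> complex poly" where
  "szego_poly \<alpha> 0 = 1"
| "szego_rev \<alpha> 0 = 1"
| "szego_poly \<alpha> (Suc n) = pCons 0 (szego_poly \<alpha> n) - smult (cnj (\<alpha> n)) (szego_rev \<alpha> n)"
| "szego_rev \<alpha> (Suc n) = szego_rev \<alpha> n - smult (\<alpha> n) (pCons 0 (szego_poly \<alpha> n))"

lemma degree_szego_le: "degree (szego_poly \<alpha> n) \<le> n \<and> degree (szego_rev \<alpha> n) \<le> n"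
proof (induction n)
  case (Suc n)
  have "degree (pCons 0 (szego_poly \<alpha> n)) \<le> Suc n"
    using Suc by (simp add: degree_pCons_le le_trans[OF degree_pCons_le])
  with Suc show ?case
    by (auto intro!: degree_diff_le intro: order_trans[OF degree_smult_le])
qed auto

lemma coeff_szego_poly_top: "coeff (szego_poly \<alpha> n) n = 1"
proof (cases n)
  case (Suc m)
  have "coeff (szego_poly \<alpha> m) m = 1" for m
  proof (induction m)
    case (Suc m)
    have "coeff (szego_rev \<alpha> m) (Suc m) = 0"
      by (intro coeff_eq_0) (use degree_szego_le[of \<alpha> m] in auto)
    with Suc show ?case by simp
  qed auto
  then show ?thesis by simp
qed auto

lemma degree_szego_poly: "degree (szego_poly \<alpha> n) = n"
  using degree_szego_le[of \<alpha> n] coeff_szego_poly_top[of \<alpha> n]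
  by (metis le_antisym le_degree one_neq_zero)

lemma coeff_szego_rev_0: "coeff (szego_rev \<alpha> n) 0 = 1"
  by (induction n) auto

text \<open>Identifies the second component as the reversed polynomial. On the circle
  \<open>cnj z\<close> is 1/z, so conjugating one line of the recursion gives the other.\<close>

lemma szego_rev_on_circle:
  assumes "norm z = 1"
  shows "poly (szego_rev \<alpha> n) z = z ^ n * cnj (poly (szego_poly \<alpha> n) z)"
proof (induction n)
  case (Suc n)
  have z: "z * cnj z = 1" using assms by (metis complex_norm_square of_real_1 one_power2)
  have "poly (szego_rev \<alpha> (Suc n)) z
      = (z * cnj z) * z ^ n * cnj (poly (szego_poly \<alpha> n) z) - \<alpha> n * z * (z ^ n * cnj (z ^ n)) * poly (szego_poly \<alpha> n) z"
  proof -
    have "z ^ n * cnj (z ^ n) = 1"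
      by (metis z complex_cnj_power power_mult_distrib power_one)
    then have "z ^ n * (cnj z ^ n * w) = w" for w by (simp flip: mult.assoc)
    then show ?thesis by (simp add: Suc z mult.assoc del: complex_cnj_power) (simp add: mult.left_commute)
  qed
  also have "\<dots> = z ^ Suc n * cnj (poly (szego_poly \<alpha> (Suc n)) z)"
    by (simp add: Suc algebra_simps)
  finally show ?case .
qed auto

lemma norm_szego_on_circle:
  assumes "norm z = 1"
  shows "norm (poly (szego_poly \<alpha> n) z) = norm (poly (szego_rev \<alpha> n) z)"
  by (simp add: szego_rev_on_circle[OF assms] norm_mult norm_power assms)

text \<open>A Moebius map of the disk in homogeneous form: the difference of the squared sides is (1
  - |a|^2)(|q|^2 - |p|^2).\<close>

lemma norm_diff_cnj_le:
  assumes "norm p \<le> norm q" "norm a \<le> 1"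
  shows "norm (p - cnj a * q) \<le> norm (q - a * p)"
proof -
  have "norm (q - a * p)^2 - norm (p - cnj a * q)^2 = (1 - norm a^2) * (norm q^2 - norm p^2)"
  proof -
    have "complex_of_real (norm (q - a * p)^2 - norm (p - cnj a * q)^2) =
        complex_of_real ((1 - norm a^2) * (norm q^2 - norm p^2))"
      unfolding of_real_diff of_real_mult complex_norm_square by (simp add: algebra_simps)
    then show ?thesis by (simp only: of_real_eq_iff)
  qed
  also have "\<dots> \<ge> 0"
    using assms by (intro mult_nonneg_nonneg) (auto simp: power_le_one power_mono)
  finally have "norm (p - cnj a * q)^2 \<le> norm (q - a * p)^2" by simp
  then show ?thesis by (simp add: power2_le_iff_abs_le)
qed

text \<open>Both claims are carried together: the bound |z p| \<le> |q| with |\<alpha>| < 1 prevents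
  cancellation in q - \<alpha> z p, and q \<noteq> 0 makes this strict. Absence of zeros in the
  closed disk is what gives the reversed polynomial a logarithm there.\<close>

lemma szego_poly_disk:
  assumes a: "\<And>n. norm (\<alpha> n) < 1" and z: "norm z \<le> 1"
  shows "norm (poly (szego_poly \<alpha> n) z) \<le> norm (poly (szego_rev \<alpha> n) z) \<and> poly (szego_rev \<alpha> n) z \<noteq> 0"
proof (induction n)
  case (Suc n)
  define p q where "p = z * poly (szego_poly \<alpha> n) z" and "q = poly (szego_rev \<alpha> n) z"
  have q: "q \<noteq> 0" using Suc by (simp add: q_def)
  have "norm p \<le> 1 * norm (poly (szego_poly \<alpha> n) z)"
    unfolding p_def norm_mult by (intro mult_right_mono z) auto
  then have pq: "norm p \<le> norm q" using Suc by (simp add: q_def)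
  have "norm (\<alpha> n * p) \<le> norm (\<alpha> n) * norm q" by (simp add: norm_mult mult_left_mono pq)
  also have "\<dots> < norm q" using a[of n] q by simp
  finally have "q - \<alpha> n * p \<noteq> 0" by auto
  with norm_diff_cnj_le[OF pq less_imp_le[OF a[of n]]] show ?case
    by (simp add: p_def q_def mult.left_commute)
qed auto

text \<open>The third Taylor coefficient of \<open>log q\<close> at \<open>0\<close>, for a polynomial with \<open>q(0) = 1\<close>.\<close>
definition log_coeff3 :: "complex poly \<Rightarrow> complex" where
  "log_coeff3 q = coeff q 3 - coeff q 1 * coeff q 2 + coeff q 1 ^ 3 / 3"

text \<open>The Taylor coefficients of order \<open>0, 1, 2\<close> of \<open>p / q\<close> at \<open>0\<close>, if \<open>q(0) = 1\<close>.\<close>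
definition schur_coeff :: "nat \<Rightarrow> complex poly \<Rightarrow> complex poly \<Rightarrow> complex" where
  "schur_coeff k p q =
     (if k = 0 then coeff p 0 else if k = 1 then coeff p 1 - coeff p 0 * coeff q 1
      else coeff p 2 - coeff p 1 * coeff q 1 + coeff p 0 * (coeff q 1 ^ 2 - coeff q 2))"

text \<open>Let f be the quotient of \<open>szego_poly\<close> by \<open>szego_rev\<close> at n, and
  a the n-th coefficient. The next quotient is (z f - cnj a) / (1 - a z f), and the logarithm of
  \<open>szego_rev\<close> grows by log (1 - a z f). The four equations are the expansions of these
  to the order needed.\<close>

lemma schur_coeff_Suc:
  fixes \<alpha> :: "nat \<Rightarrow> complex" and n
  defines "a \<equiv> \<alpha> n" and "b \<equiv> \<lambda>k n. schur_coeff k (szego_poly \<alpha> n) (szego_rev \<alpha> n)"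
  shows "b 0 (Suc n) = - cnj a"
    and "b 1 (Suc n) = (1 - a * cnj a) * b 0 n"
    and "b 2 (Suc n) = (1 - a * cnj a) * (b 1 n + a * b 0 n ^ 2)"
    and "log_coeff3 (szego_rev \<alpha> (Suc n)) - log_coeff3 (szego_rev \<alpha> n) =
       - a * b 2 n - a ^ 2 * b 0 n * b 1 n - a ^ 3 * b 0 n ^ 3 / 3"
proof -
  note [simp] = coeff_szego_rev_0 coeff_pCons
  show "b 0 (Suc n) = - cnj a" by (simp add: b_def a_def schur_coeff_def)
  show "b 1 (Suc n) = (1 - a * cnj a) * b 0 n"
    by (simp add: b_def a_def schur_coeff_def algebra_simps)
  show "b 2 (Suc n) = (1 - a * cnj a) * (b 1 n + a * b 0 n ^ 2)"
    by (simp add: b_def a_def schur_coeff_def algebra_simps power2_eq_square eval_nat_numeral)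
  show "log_coeff3 (szego_rev \<alpha> (Suc n)) - log_coeff3 (szego_rev \<alpha> n) =
       - a * b 2 n - a ^ 2 * b 0 n * b 1 n - a ^ 3 * b 0 n ^ 3 / 3"
    by (simp add: b_def a_def schur_coeff_def log_coeff3_def field_simps power2_eq_square power3_eq_cube eval_nat_numeral)
qed

text \<open>Three steps of the recursion express all Taylor coefficients involved by Verblunsky
  coefficients. Closer to the start the initial value 1 of the quotient would enter, so the formula
  begins with the increment at index 3.\<close>

lemma log_coeff3_step:
  fixes \<alpha> :: "nat \<Rightarrow> complex" and n
  defines "a \<equiv> \<alpha> n" and "b \<equiv> \<alpha> (n + 1)" and "c \<equiv> \<alpha> (n + 2)" and "d \<equiv> \<alpha> (n + 3)"
  shows "log_coeff3 (szego_rev \<alpha> (n + 4)) - log_coeff3 (szego_rev \<alpha> (n + 3)) =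
    (1 - c * cnj c) * (1 - b * cnj b) * d * cnj a - (1 - c * cnj c) * d * c * cnj b ^ 2
     - (1 - c * cnj c) * d ^ 2 * cnj c * cnj b + d ^ 3 * cnj c ^ 3 / 3"
proof -
  \<comment> \<open>Conjugates become independent variables, which leaves a plain polynomial
    identity.\<close>
  have ring_id: "- d * ((1 - c * c') * (- (1 - b * b') * a' + c * b' ^ 2))
     - d ^ 2 * (- c') * (- (1 - c * c') * b') - d ^ 3 * (- c') ^ 3 / 3
     = (1 - c * c') * (1 - b * b') * d * a' - (1 - c * c') * d * c * b' ^ 2
     - (1 - c * c') * d ^ 2 * c' * b' + d ^ 3 * c' ^ 3 / 3" for a' b c d b' c' :: complex
    by (simp add: algebra_simps power2_eq_square power3_eq_cube)
  have n: "n + 4 = Suc (n + 3)" "n + 3 = Suc (n + 2)" "n + 2 = Suc (n + 1)" "n + 1 = Suc n" by simp_all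
  note S = schur_coeff_Suc[of \<alpha>]
  have b0: "schur_coeff 0 (szego_poly \<alpha> (n+1)) (szego_rev \<alpha> (n+1)) = - cnj a"
    "schur_coeff 0 (szego_poly \<alpha> (n+2)) (szego_rev \<alpha> (n+2)) = - cnj b"
    "schur_coeff 0 (szego_poly \<alpha> (n+3)) (szego_rev \<alpha> (n+3)) = - cnj c"
    using S(1)[of n] S(1)[of "n+1"] S(1)[of "n+2"] by (simp_all add: a_def b_def c_def numeral_3_eq_3 del: szego_poly.simps szego_rev.simps)
  have b1: "schur_coeff 1 (szego_poly \<alpha> (n+2)) (szego_rev \<alpha> (n+2)) = - (1 - b * cnj b) * cnj a"
    "schur_coeff 1 (szego_poly \<alpha> (n+3)) (szego_rev \<alpha> (n+3)) = - (1 - c * cnj c) * cnj b"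
    using S(2)[of "n+1"] S(2)[of "n+2"] b0
    by (simp_all add: b_def c_def numeral_3_eq_3 algebra_simps del: szego_poly.simps szego_rev.simps)
  have b2: "schur_coeff 2 (szego_poly \<alpha> (n+3)) (szego_rev \<alpha> (n+3)) = (1 - c * cnj c) * (- (1 - b * cnj b) * cnj a + c * cnj b ^ 2)"
    using S(3)[of "n+2"] b0 b1 by (simp add: b_def c_def numeral_3_eq_3 del: szego_poly.simps szego_rev.simps)
  have "log_coeff3 (szego_rev \<alpha> (Suc (n + 3))) - log_coeff3 (szego_rev \<alpha> (n + 3)) =
     - d * ((1 - c * cnj c) * (- (1 - b * cnj b) * cnj a + c * cnj b ^ 2))
     - d ^ 2 * (- cnj c) * (- (1 - c * cnj c) * cnj b) - d ^ 3 * (- cnj c) ^ 3 / 3"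
    (is "_ = ?L") unfolding S(4) b0 b1 b2 d_def by simp
  also have "\<dots> = (1 - c * cnj c) * (1 - b * cnj b) * d * cnj a - (1 - c * cnj c) * d * c * cnj b ^ 2
     - (1 - c * cnj c) * d ^ 2 * cnj c * cnj b + d ^ 3 * cnj c ^ 3 / 3"
    by (rule ring_id)
  finally show ?thesis unfolding n(1) .
qed

section \<open>The increments of the sum rule\<close>

lemma norm_mult_diff_le:
  fixes u v x y :: complex
  shows "norm (u * v - x * y) \<le> norm (u - x) * norm (v - y) + norm x * norm (v - y) + norm y * norm (u - x)"
proof -
  have "u * v - x * y = (u - x) * (v - y) + x * (v - y) + y * (u - x)" by (simp add: algebra_simps)
  then show ?thesis by (metis norm_mult norm_triangle_mono order_refl)
qed

lemma prod2_close:
  fixes u v x y :: complex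
  assumes "norm (u - x) \<le> \<delta>" "norm (v - y) \<le> \<delta>" "norm x \<le> r" "norm y \<le> r" 
  shows "norm (u * v - x * y) \<le> 2 * r * \<delta> + \<delta>\<^sup>2"
proof -
  have "norm (u - x) * norm (v - y) \<le> \<delta> * \<delta>" "norm x * norm (v - y) \<le> r * \<delta>" "norm y * norm (u - x) \<le> r * \<delta>"
    by (intro mult_mono; use assms in \<open>auto intro: order_trans[OF norm_ge_zero]\<close>)+
  with norm_mult_diff_le[of u v x y] show ?thesis by (simp add: power2_eq_square)
qed

text \<open>Replacing one factor costs r^3 \<delta>, weakened to r^2 \<delta> by r \<le> 1; the
  surviving factor r^2 is the point. The bound 6 (three differences, each at most 2) serves to
  absorb higher powers of \<delta> into \<delta>^2.\<close>

lemma prod4_close: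
  fixes u1 u2 u3 u4 v1 v2 v3 v4 :: complex
  assumes u: "norm (u1 - v1) \<le> \<delta>" "norm (u2 - v2) \<le> \<delta>" "norm (u3 - v3) \<le> \<delta>" "norm (u4 - v4) \<le> \<delta>"
    and v: "norm v1 = r" "norm v2 = r" "norm v3 = r" "norm v4 = r"
    and r: "r \<le> 1" and d: "\<delta> \<le> 6"
  shows "norm (u1 * u2 * (u3 * u4) - v1 * v2 * (v3 * v4)) \<le> 4 * r\<^sup>2 * \<delta> + 70 * \<delta>\<^sup>2"
proof -
  define \<eta> where "\<eta> = 2 * r * \<delta> + \<delta>\<^sup>2"
  have r0: "0 \<le> r" using v(1) norm_ge_zero by metis
  have d0: "0 \<le> \<delta>" using u(1) norm_ge_zero order_trans by blast
  have e0: "0 \<le> \<eta>" using r0 d0 by (simp add: \<eta>_def)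
  have U: "norm (u1 * u2 - v1 * v2) \<le> \<eta>" "norm (u3 * u4 - v3 * v4) \<le> \<eta>"
    unfolding \<eta>_def by (intro prod2_close; use u v in auto)+
  have "norm (u1 * u2 - v1 * v2) * norm (u3 * u4 - v3 * v4) \<le> \<eta> * \<eta>"
    by (intro mult_mono U) (use e0 in auto)
  moreover have "norm (v1 * v2) * norm (u3 * u4 - v3 * v4) \<le> r\<^sup>2 * \<eta>"
    by (intro mult_mono U) (auto simp: norm_mult v power2_eq_square)
  moreover have "norm (v3 * v4) * norm (u1 * u2 - v1 * v2) \<le> r\<^sup>2 * \<eta>"
    by (intro mult_mono U) (auto simp: norm_mult v power2_eq_square)
  ultimately have 1: "norm (u1 * u2 * (u3 * u4) - v1 * v2 * (v3 * v4)) \<le> \<eta> * \<eta> + 2 * r\<^sup>2 * \<eta>"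
    using norm_mult_diff_le[of "u1 * u2" "u3 * u4" "v1 * v2" "v3 * v4"] by linarith
  have "2 * r * \<delta> \<le> 2 * 1 * \<delta>" "\<delta> * \<delta> \<le> 6 * \<delta>"
    by (intro mult_right_mono mult_left_mono; use r d d0 in auto)+
  then have "\<eta> \<le> 8 * \<delta>" by (simp add: \<eta>_def power2_eq_square)
  then have "\<eta> * \<eta> \<le> (8 * \<delta>) * (8 * \<delta>)" using e0 d0 by (intro mult_mono) auto
  then have 2: "\<eta> * \<eta> \<le> 64 * \<delta>\<^sup>2" by (simp add: power2_eq_square)
  have r1: "r\<^sup>2 \<le> 1" using r r0 by (simp add: power_le_one)
  have "r\<^sup>2 * (r * \<delta>) \<le> r\<^sup>2 * (1 * \<delta>)"
    by (intro mult_left_mono mult_right_mono) (use r d0 in auto)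
  moreover have "r\<^sup>2 * \<delta>\<^sup>2 \<le> 1 * \<delta>\<^sup>2" by (intro mult_right_mono r1) auto
  ultimately have "2 * r\<^sup>2 * \<eta> \<le> 4 * r\<^sup>2 * \<delta> + 2 * \<delta>\<^sup>2" by (simp add: \<eta>_def algebra_simps)
  moreover have "0 \<le> \<delta>\<^sup>2" by simp
  ultimately show ?thesis using 1 2 by linarith
qed

text \<open>A quartic block times a pair: the block error is multiplied by at most 1, the pair error
  by r^4.\<close>

lemma prod6_close:
  fixes u1 u2 u3 u4 u5 u6 v1 v2 v3 v4 v5 v6 :: complex
  assumes u: "norm (u1 - v1) \<le> \<delta>" "norm (u2 - v2) \<le> \<delta>" "norm (u3 - v3) \<le> \<delta>" "norm (u4 - v4) \<le> \<delta>"
    "norm (u5 - v5) \<le> \<delta>" "norm (u6 - v6) \<le> \<delta>"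
    and v: "norm v1 = r" "norm v2 = r" "norm v3 = r" "norm v4 = r" "norm v5 = r" "norm v6 = r"
    and u1: "norm u5 \<le> 1" "norm u6 \<le> 1" and r: "r \<le> 1" and d: "\<delta> \<le> 6"
  shows "norm (u1 * u2 * (u3 * u4) * (u5 * u6) - v1 * v2 * (v3 * v4) * (v5 * v6)) \<le> 6 * r\<^sup>2 * \<delta> + 71 * \<delta>\<^sup>2"
proof -
  let ?U = "u1 * u2 * (u3 * u4)" and ?V = "v1 * v2 * (v3 * v4)"
  have r0: "0 \<le> r" using v(1) norm_ge_zero by metis
  have d0: "0 \<le> \<delta>" using u(1) norm_ge_zero order_trans by blast
  have r1: "r\<^sup>2 \<le> 1" using r r0 by (simp add: power_le_one)
  have "?U * (u5 * u6) - ?V * (v5 * v6) = (?U - ?V) * (u5 * u6) + ?V * (u5 * u6 - v5 * v6)"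
    by (simp add: algebra_simps)
  then have "norm (?U * (u5 * u6) - ?V * (v5 * v6))
      \<le> norm (?U - ?V) * norm (u5 * u6) + norm ?V * norm (u5 * u6 - v5 * v6)"
    by (metis norm_mult norm_triangle_ineq)
  moreover have "norm (?U - ?V) * norm (u5 * u6) \<le> (4 * r\<^sup>2 * \<delta> + 70 * \<delta>\<^sup>2) * 1"
  proof (intro mult_mono)
    show "norm (?U - ?V) \<le> 4 * r\<^sup>2 * \<delta> + 70 * \<delta>\<^sup>2" by (rule prod4_close) (use assms in auto)
    show "norm (u5 * u6) \<le> 1" using u1 by (simp add: norm_mult mult_le_one)
  qed (use d0 in auto)
  moreover have "norm ?V * norm (u5 * u6 - v5 * v6) \<le> (r\<^sup>2 * r\<^sup>2) * (2 * r * \<delta> + \<delta>\<^sup>2)"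
    by (intro mult_mono prod2_close) (use u v in \<open>auto simp: norm_mult power2_eq_square\<close>)
  moreover have "(r\<^sup>2 * r\<^sup>2) * (2 * r * \<delta> + \<delta>\<^sup>2) \<le> 2 * r\<^sup>2 * \<delta> + \<delta>\<^sup>2"
  proof -
    have "r\<^sup>2 * (r\<^sup>2 * r) \<le> r\<^sup>2 * (1 * 1)"
      by (intro mult_left_mono mult_mono) (use r r0 r1 in auto)
    then have "r\<^sup>2 * (r\<^sup>2 * r) * \<delta> \<le> r\<^sup>2 * \<delta>" using d0 by (intro mult_right_mono) auto
    moreover have "(r\<^sup>2 * r\<^sup>2) * \<delta>\<^sup>2 \<le> 1 * \<delta>\<^sup>2"
      by (intro mult_right_mono mult_le_one r1) auto
    ultimately show ?thesis by (simp add: algebra_simps)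
  qed
  ultimately show ?thesis by (simp add: algebra_simps)
qed

text \<open>The increment found in \<open>log_coeff3_step\<close>; the arguments are four
  consecutive Verblunsky coefficients.\<close>

definition step_poly :: "complex \<Rightarrow> complex \<Rightarrow> complex \<Rightarrow> complex \<Rightarrow> complex" where
  "step_poly a b c d = (1 - c * cnj c) * (1 - b * cnj b) * d * cnj a - (1 - c * cnj c) * d * c * cnj b ^ 2
     - (1 - c * cnj c) * d ^ 2 * cnj c * cnj b + d ^ 3 * cnj c ^ 3 / 3"

text \<open>Compares with the case of four equal coefficients, where the value is x - 4 x^2 + 10/3
  x^3: four quartic terms, and sextic terms of weights 1, 1, 1, 1/3. Freezing the coefficients in
  the quadratic term too would cost |d| \<delta>, which |d|^4 and \<delta>^2 do not control; that
  term is kept exact.\<close>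

lemma step_poly_close:
  assumes n: "norm a \<le> 1" "norm b \<le> 1" "norm c \<le> 1" "norm d \<le> 1"
  defines "x \<equiv> (norm d)\<^sup>2" and "\<delta> \<equiv> norm (a - d) + norm (b - d) + norm (c - d)"
  shows "\<bar>Re (step_poly a b c d) - (((norm a)\<^sup>2 + x - (norm (a - d))\<^sup>2) / 2 - 4 * x\<^sup>2 + 10 / 3 * x ^ 3)\<bar>
    \<le> x\<^sup>2 / 2 + 2000 * \<delta>\<^sup>2"
proof -
  define r where "r = norm d"
  have rx: "r\<^sup>2 = x" by (simp add: r_def x_def)
  have d6: "\<delta> \<le> 6"
    using norm_triangle_ineq4[of a d] norm_triangle_ineq4[of b d] norm_triangle_ineq4[of c d] n
    unfolding \<delta>_def by linarith
  have d0: "0 \<le> \<delta>" by (simp add: \<delta>_def)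
  have close: "norm (a - d) \<le> \<delta>" "norm (b - d) \<le> \<delta>" "norm (c - d) \<le> \<delta>" "norm (d - d) \<le> \<delta>"
    by (auto simp: \<delta>_def)
  have cclose: "norm (cnj a - cnj d) \<le> \<delta>" "norm (cnj b - cnj d) \<le> \<delta>" "norm (cnj c - cnj d) \<le> \<delta>" "norm (cnj d - cnj d) \<le> \<delta>"
    using close by (metis complex_cnj_diff complex_mod_cnj)+
  have r1: "r \<le> 1" using n by (simp add: r_def)
  define E4 E6 where "E4 = 4 * r\<^sup>2 * \<delta> + 70 * \<delta>\<^sup>2" and "E6 = 6 * r\<^sup>2 * \<delta> + 71 * \<delta>\<^sup>2"
  note p4 = prod4_close[where r=r and \<delta>=\<delta>, OF _ _ _ _ _ _ _ _ r1 d6, folded E4_def]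
  note p6 = prod6_close[where r=r and \<delta>=\<delta>, OF _ _ _ _ _ _ _ _ _ _ _ _ _ _ r1 d6, folded E6_def]
  have dd: "d * cnj d = of_real x" unfolding x_def by (rule complex_norm_square[symmetric])
  have V4: "of_real (x^2) = d * cnj d * (d * cnj d)"
    by (simp only: dd of_real_mult power2_eq_square)
  have V6: "of_real (x^3) = d * cnj d * (d * cnj d) * (d * cnj d)"
    by (simp only: dd of_real_mult power3_eq_cube)
  have nd: "norm d = r" "norm (cnj d) = r" by (simp_all add: r_def)
  have n': "norm (cnj c) \<le> 1" "norm (cnj d) \<le> 1" using n by simp_all
  have e1: "norm (c * cnj c * (d * cnj a) - of_real (x^2)) \<le> E4"
    unfolding V4 by (rule p4) (rule close cclose nd)+
  have e2: "norm (b * cnj b * (d * cnj a) - of_real (x^2)) \<le> E4"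
    unfolding V4 by (rule p4) (rule close cclose nd)+
  have e3: "norm (d * cnj b * (c * cnj b) - of_real (x^2)) \<le> E4"
    unfolding V4 by (rule p4) (rule close cclose nd)+
  have e4: "norm (d * cnj c * (d * cnj b) - of_real (x^2)) \<le> E4"
    unfolding V4 by (rule p4) (rule close cclose nd)+
  have f1: "norm (b * cnj b * (d * cnj a) * (c * cnj c) - of_real (x^3)) \<le> E6"
    unfolding V6 by (rule p6) (rule close cclose nd n n')+
  have f2: "norm (d * cnj b * (c * cnj b) * (c * cnj c) - of_real (x^3)) \<le> E6"
    unfolding V6 by (rule p6) (rule close cclose nd n n')+
  have f3: "norm (d * cnj c * (d * cnj b) * (c * cnj c) - of_real (x^3)) \<le> E6"
    unfolding V6 by (rule p6) (rule close cclose nd n n')+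
  have f4: "norm (d * cnj c * (d * cnj c) * (d * cnj c) - of_real (x^3)) \<le> E6"
    unfolding V6 by (rule p6) (rule close cclose nd n n')+
  have R: "\<bar>Re u - y\<bar> \<le> E" if "norm (u - of_real y) \<le> E" for u y E
    using abs_Re_le_cmod[of "u - of_real y"] that by simp
  \<comment> \<open>Polarization of the quadratic term.\<close>
  have main: "Re (d * cnj a) = ((norm a)\<^sup>2 + x - (norm (a - d))\<^sup>2) / 2"
    unfolding x_def cmod_power2 by (simp add: power2_eq_square algebra_simps)
  have ring_id: "(1 - c * c') * (1 - b * b') * d * a' - (1 - c * c') * d * c * b' ^ 2
     - (1 - c * c') * d ^ 2 * c' * b' + d ^ 3 * c' ^ 3 / 3
     = d * a' - c * c' * (d * a') - b * b' * (d * a') - d * b' * (c * b') - d * c' * (d * b')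
     + b * b' * (d * a') * (c * c') + d * b' * (c * b') * (c * c')
     + d * c' * (d * b') * (c * c') + d * c' * (d * c') * (d * c') / 3" for a' b c d b' c' :: complex
    by (simp add: algebra_simps power2_eq_square power3_eq_cube)
  have "Re (step_poly a b c d) = Re (d * cnj a) - Re (c * cnj c * (d * cnj a)) - Re (b * cnj b * (d * cnj a))
     - Re (d * cnj b * (c * cnj b)) - Re (d * cnj c * (d * cnj b))
     + Re (b * cnj b * (d * cnj a) * (c * cnj c)) + Re (d * cnj b * (c * cnj b) * (c * cnj c))
     + Re (d * cnj c * (d * cnj b) * (c * cnj c)) + Re (d * cnj c * (d * cnj c) * (d * cnj c)) / 3"
    unfolding step_poly_def ring_id by (simp only: plus_complex.simps minus_complex.simps Re_divide_numeral)
  moreover have lin: "\<bar>m - t1 - t2 - t3 - t4 + s1 + s2 + s3 + s4 / 3 - (m - 4 * y + 10 / 3 * w)\<bar> \<le> 4 * E4 + 10 / 3 * E6"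
    if "\<bar>t1 - y\<bar> \<le> E4" "\<bar>t2 - y\<bar> \<le> E4" "\<bar>t3 - y\<bar> \<le> E4" "\<bar>t4 - y\<bar> \<le> E4"
      "\<bar>s1 - w\<bar> \<le> E6" "\<bar>s2 - w\<bar> \<le> E6" "\<bar>s3 - w\<bar> \<le> E6" "\<bar>s4 - w\<bar> \<le> E6"
    for m t1 t2 t3 t4 s1 s2 s3 s4 y w :: real
    using that unfolding abs_le_iff by linarith
  ultimately have "\<bar>Re (step_poly a b c d) - (((norm a)\<^sup>2 + x - (norm (a - d))\<^sup>2) / 2 - 4 * x\<^sup>2 + 10 / 3 * x ^ 3)\<bar> \<le> 4 * E4 + 10/3 * E6"
    unfolding main
    by (simp only:) (rule lin[OF R[OF e1] R[OF e2] R[OF e3] R[OF e4] R[OF f1] R[OF f2] R[OF f3] R[OF f4]])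
  also have "\<dots> \<le> x\<^sup>2 / 2 + 2000 * \<delta>\<^sup>2"
  proof -
    \<comment> \<open>The linear error has coefficient 36 = 4 * 4 + 10/3 * 6. Half of this square
      bounds 36 x \<delta> by x^2 / 2 + 648 \<delta>^2, and 648 + 4 * 70 + 10/3 * 71 is below
      2000.\<close>
    have "0 \<le> (x - 36 * \<delta>)\<^sup>2" by simp
    then have "72 * x * \<delta> \<le> x\<^sup>2 + 1296 * \<delta>\<^sup>2" by (simp add: power2_eq_square algebra_simps)
    moreover have "0 \<le> \<delta>\<^sup>2" by simp
    ultimately show ?thesis unfolding E4_def E6_def rx by argo
  qed
  finally show ?thesis .
qed

lemma ln_one_minus_le:
  assumes "0 \<le> (x::real)" "x < 1"
  shows "ln (1 - x) \<le> - x - x\<^sup>2 / 2 - x ^ 3 / 3"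
proof -
  define f where "f = (\<lambda>x. ln (1 - x) + x + x\<^sup>2 / 2 + x ^ 3 / (3::real))"
  have "f x \<le> f 0"
  proof (rule DERIV_nonpos_imp_nonincreasing[OF assms(1)])
    fix y assume y: "0 \<le> y" "y \<le> x"
    have "(f has_real_derivative (-1 / (1 - y) + 1 + y + y\<^sup>2)) (at y)"
      unfolding f_def by (rule derivative_eq_intros refl | use y assms in \<open>force simp: field_simps power2_eq_square\<close>)+
    moreover have "-1 / (1 - y) + 1 + y + y\<^sup>2 = - (y ^ 3) / (1 - y)"
      using y assms by (simp add: field_simps power2_eq_square power3_eq_cube)
    moreover have "\<dots> \<le> 0" using y assms by simp
    ultimately show "\<exists>D. (f has_real_derivative D) (at y) \<and> D \<le> 0" by metis
  qed
  then show ?thesis by (simp add: f_def)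
qed

text \<open>The linear term of the logarithm cancels against the polarized quadratic term up to the
  difference that telescopes. With x = |d|^2 the upper bound keeps (-1/2 - 4 + 1/2) x^2 + 3 x^3, at
  most -x^2 as x < 1. The lower bound keeps at least (-2 - 4 - 1/2) x^2, where ln (1 - x) \<ge> -x -
  2 x^2 is what requires x \<le> 1/2.\<close>

lemma step_bounds:
  fixes a b c d :: complex
  assumes n: "norm a \<le> 1" "norm b \<le> 1" "norm c \<le> 1" "norm d < 1"
  defines "t \<equiv> ln (1 - (norm d)\<^sup>2) + Re (step_poly a b c d)"
    and "D \<equiv> 27 * ((norm (b - a))\<^sup>2 + (norm (c - b))\<^sup>2 + (norm (d - c))\<^sup>2)"
  shows "t \<le> ((norm a)\<^sup>2 - (norm d)\<^sup>2) / 2 - norm d ^ 4 + 2000 * D"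
    and "(norm d)\<^sup>2 \<le> 1 / 2 \<Longrightarrow> ((norm a)\<^sup>2 - (norm d)\<^sup>2) / 2 - 7 * norm d ^ 4 - 2001 * D \<le> t"
proof -
  define x where "x = (norm d)\<^sup>2"
  define \<delta> where "\<delta> = norm (a - d) + norm (b - d) + norm (c - d)"
  have x4: "norm d ^ 4 = x\<^sup>2" by (simp add: x_def)
  have x: "0 \<le> x" "x < 1" using n by (auto simp: x_def power_less_one_iff abs_square_less_1)
  \<comment> \<open>The three distances to d pass over 3, 2 and 1 of the consecutive differences, so
    each of these is counted at most three times. Cauchy-Schwarz then turns 9 into 27.\<close>
  have le: "\<delta> \<le> 3 * (norm (b - a) + norm (c - b) + norm (d - c))"
  proof -
    have "norm (a - c) \<le> norm (b - a) + norm (c - b)" "norm (a - d) \<le> norm (a - c) + norm (d - c)"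
      "norm (b - d) \<le> norm (c - b) + norm (d - c)" "norm (c - d) = norm (d - c)"
      using norm_triangle_ineq[of "a - b" "b - c"] norm_triangle_ineq[of "a - c" "c - d"] norm_triangle_ineq[of "b - c" "c - d"]
      by (simp_all add: norm_minus_commute)
    then show ?thesis unfolding \<delta>_def distrib_left
      using norm_ge_zero[of "b - a"] norm_ge_zero[of "c - b"] norm_ge_zero[of "d - c"] by linarith
  qed
  have cs: "(3 * (u + v + w))\<^sup>2 \<le> 27 * (u\<^sup>2 + v\<^sup>2 + w\<^sup>2)" for u v w :: real
  proof -
    have "0 \<le> 9 * ((u - v)\<^sup>2 + (v - w)\<^sup>2 + (u - w)\<^sup>2)" by simp
    then show ?thesis by (simp add: power2_eq_square algebra_simps)
  qed
  have "\<delta>\<^sup>2 \<le> (3 * (norm (b - a) + norm (c - b) + norm (d - c)))\<^sup>2"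
    by (intro power_mono le) (simp add: \<delta>_def)
  then have D: "\<delta>\<^sup>2 \<le> D" unfolding D_def using cs order_trans by blast
  have ad: "(norm (a - d))\<^sup>2 \<le> \<delta>\<^sup>2" by (intro power_mono) (auto simp: \<delta>_def)
  have ad0: "0 \<le> (norm (a - d))\<^sup>2" by simp
  note close = step_poly_close[OF n(1-3) less_imp_le[OF n(4)], folded x_def \<delta>_def, unfolded abs_le_iff]
  have x3: "x ^ 3 \<le> x\<^sup>2" "0 \<le> x ^ 3" using x power_decreasing[of 2 3 x] by auto
  show "t \<le> ((norm a)\<^sup>2 - (norm d)\<^sup>2) / 2 - norm d ^ 4 + 2000 * D"
    unfolding t_def x4 x_def[symmetric]
    using ln_one_minus_le[OF x] close D ad0 x3 by argo
  assume "(norm d)\<^sup>2 \<le> 1 / 2"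
  then have "- x - 2 * x\<^sup>2 \<le> ln (1 - x)"
    using ln_one_minus_pos_lower_bound[of x] x by (simp add: x_def)
  then show "((norm a)\<^sup>2 - (norm d)\<^sup>2) / 2 - 7 * norm d ^ 4 - 2001 * D \<le> t"
    unfolding t_def x4 x_def[symmetric]
    using close D ad x3 by argo
qed

lemma sum_telescope3:
  fixes f :: "nat \<Rightarrow> real"
  shows "(\<Sum>j<n. f j - f (j + 3)) = f 0 + f 1 + f 2 - (f n + f (n + 1) + f (n + 2))"
  by (induction n) (simp_all add: eval_nat_numeral)

text \<open>Summing \<open>step_bounds\<close>: the telescoping part and the squared differences are
  bounded, so the partial sums of t are bounded below exactly when those of |\<alpha>|^4 are bounded
  above.\<close>

lemma bounded_step_sums_iff_ell4:
  fixes \<alpha> :: "nat \<Rightarrow> complex"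
  assumes a: "\<And>n. norm (\<alpha> n) < 1" and d: "summable (\<lambda>n. (norm (\<alpha> (Suc n) - \<alpha> n))\<^sup>2)"
  defines "t \<equiv> \<lambda>n. ln (1 - (norm (\<alpha> (n + 3)))\<^sup>2) + Re (step_poly (\<alpha> n) (\<alpha> (n + 1)) (\<alpha> (n + 2)) (\<alpha> (n + 3)))"
  shows "(\<exists>B. \<forall>n. B \<le> (\<Sum>j<n. t j)) \<longleftrightarrow> summable (\<lambda>n. norm (\<alpha> n) ^ 4)"
proof -
  define D where "D n = 27 * ((norm (\<alpha> (n + 1) - \<alpha> n))\<^sup>2 + (norm (\<alpha> (n + 2) - \<alpha> (n + 1)))\<^sup>2
    + (norm (\<alpha> (n + 3) - \<alpha> (n + 2)))\<^sup>2)" for n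
  have D0: "0 \<le> D n" for n by (simp add: D_def)
  have "summable (\<lambda>n. (norm (\<alpha> (Suc (n + k)) - \<alpha> (n + k)))\<^sup>2)" for k
    using d by (subst summable_iff_shift)
  from this[of 0] this[of 1] this[of 2] have Ds: "summable D"
    unfolding D_def by (intro summable_mult summable_add) (simp_all add: eval_nat_numeral)
  define f where "f n = (norm (\<alpha> n))\<^sup>2 / 2" for n
  have f: "0 \<le> f n" "f n \<le> 1 / 2" for n
    using a[of n] by (auto simp: f_def abs_square_le_1)
  have tel: "\<bar>\<Sum>j<n. f j - f (j + 3)\<bar> \<le> 3 / 2" for n
    unfolding sum_telescope3 using f[of 0] f[of 1] f[of 2] f[of n] f[of "n+1"] f[of "n+2"] by linarith
  have up: "t n \<le> (f n - f (n + 3)) - norm (\<alpha> (n + 3)) ^ 4 + 2000 * D n" for n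
    using step_bounds(1)[of "\<alpha> n" "\<alpha> (n+1)" "\<alpha> (n+2)" "\<alpha> (n+3)"] a less_imp_le[OF a]
    by (simp add: t_def D_def f_def diff_divide_distrib)
  \<comment> \<open>As \<open>f\<close> is half of the square, 1/4 encodes |\<alpha>|^2 \<le>
    1/2.\<close>
  have low: "(f n - f (n + 3)) - 7 * norm (\<alpha> (n + 3)) ^ 4 - 2001 * D n \<le> t n" if "f (n + 3) \<le> 1 / 4" for n
    using step_bounds(2)[of "\<alpha> n" "\<alpha> (n+1)" "\<alpha> (n+2)" "\<alpha> (n+3)"] a less_imp_le[OF a] that
    by (simp add: t_def D_def f_def diff_divide_distrib)
  have shift: "summable (\<lambda>n. norm (\<alpha> (n + 3)) ^ 4) \<longleftrightarrow> summable (\<lambda>n. norm (\<alpha> n) ^ 4)"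
    by (rule summable_iff_shift)
  show ?thesis
  proof
    assume "\<exists>B. \<forall>n. B \<le> (\<Sum>j<n. t j)"
    then obtain B where B: "\<And>n. B \<le> (\<Sum>j<n. t j)" by blast
    have "(\<Sum>j\<le>n. norm (\<alpha> (j + 3)) ^ 4) \<le> 3 / 2 + 2000 * suminf D - B" for n
    proof -
      have "(\<Sum>j<Suc n. t j) \<le> (\<Sum>j<Suc n. (f j - f (j + 3)) - norm (\<alpha> (j + 3)) ^ 4 + 2000 * D j)"
        by (intro sum_mono up)
      also have "\<dots> = (\<Sum>j<Suc n. f j - f (j + 3)) - (\<Sum>j<Suc n. norm (\<alpha> (j + 3)) ^ 4) + 2000 * (\<Sum>j<Suc n. D j)"
        by (simp only: sum.distrib sum_subtractf sum_distrib_left)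
      finally show ?thesis
        using B[of "Suc n"] tel[of "Suc n"] sum_le_suminf[OF Ds, of "{..<Suc n}"] D0
        unfolding lessThan_Suc_atMost abs_le_iff by auto
    qed
    then have "summable (\<lambda>n. norm (\<alpha> (n + 3)) ^ 4)"
      by (intro bounded_imp_summable) auto
    then show "summable (\<lambda>n. norm (\<alpha> n) ^ 4)" by (simp only: shift)
  next
    assume S: "summable (\<lambda>n. norm (\<alpha> n) ^ 4)"
    then have S3: "summable (\<lambda>n. norm (\<alpha> (n + 3)) ^ 4)" by (simp only: shift)
    have "eventually (\<lambda>n. norm (\<alpha> (n + 3)) ^ 4 < 1 / 4) sequentially"
      by (rule order_tendstoD(2)[OF summable_LIMSEQ_zero[OF S3]]) simp
    then obtain N where N: "\<And>n. n \<ge> N \<Longrightarrow> norm (\<alpha> (n + 3)) ^ 4 < 1 / 4"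
      unfolding eventually_sequentially by blast
    have f4: "f (n + 3) \<le> 1 / 4" if "n \<ge> N" for n
    proof -
      have "((norm (\<alpha> (n + 3)))\<^sup>2)\<^sup>2 < (1 / 2)\<^sup>2" using N[OF that] by (simp add: power2_eq_square eval_nat_numeral)
      then show ?thesis using power2_less_imp_less[of "(norm (\<alpha> (n + 3)))\<^sup>2" "1/2"] by (simp add: f_def)
    qed
    define v where "v n = 7 * norm (\<alpha> (n + 3)) ^ 4 + 2001 * D n" for n
    \<comment> \<open>The lower bound is available only from N on. Before N, the value 1 + |t n|
      makes the same inequality trivial, as \<open>f\<close> lies in [0, 1/2].\<close>
    define u where "u n = (if n < N then 1 + \<bar>t n\<bar> else v n)" for n
    have u0: "0 \<le> u n" for n using D0[of n] by (auto simp: u_def v_def)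
    have "summable v" unfolding v_def by (intro summable_add summable_mult S3 Ds)
    moreover have "eventually (\<lambda>n. u n = v n) sequentially"
      using eventually_ge_at_top[of N] by eventually_elim (auto simp: u_def)
    ultimately have us: "summable u" using summable_cong by blast
    have tu: "(f n - f (n + 3)) - u n \<le> t n" for n
    proof (cases "n < N")
      case True
      then show ?thesis using f[of n] f[of "n+3"] by (auto simp: u_def)
        next
      case False
      then show ?thesis using low[OF f4[of n]] by (simp add: u_def v_def)
    qed
    have "- 3 / 2 - suminf u \<le> (\<Sum>j<n. t j)" for n
    proof -
      have "(\<Sum>j<n. (f j - f (j + 3)) - u j) \<le> (\<Sum>j<n. t j)" by (intro sum_mono tu)
      then show ?thesis
        using tel[of n] sum_le_suminf[OF us, of "{..<n}"] u0
        unfolding sum_subtractf[of "\<lambda>j. f j - f (j + 3)"] abs_le_iff by auto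
    qed
    then show "\<exists>B. \<forall>n. B \<le> (\<Sum>j<n. t j)" by blast
  qed
qed

section \<open>Integrals over the unit circle\<close>

lemma angle_measure_density:
  "angle_measure = density lborel (\<lambda>x. ennreal (indicator {0..2 * pi} x / (2 * pi)))"
  unfolding angle_measure_def uniform_measure_def
  by (intro density_cong) (auto simp: divide_ennreal[symmetric] split: split_indicator simp flip: ennreal_1)

lemma sets_angle_measure [simp, measurable_cong]: "sets angle_measure = sets borel"
  by (simp add: angle_measure_def)

lemma space_angle_measure [simp]: "space angle_measure = UNIV"
  by (simp add: angle_measure_def)

lemma prob_space_angle_measure: "prob_space angle_measure"
  unfolding angle_measure_def by (intro prob_space_uniform_measure) auto

lemma space_circle_borel [simp]: "space circle_borel = sphere 0 1"
  by (simp add: circle_borel_def space_restrict_space)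

lemma cis_measurable [measurable]: "cis \<in> measurable angle_measure circle_borel"
proof -
  have "cis \<in> borel_measurable borel" by (intro borel_measurable_continuous_onI continuous_intros)
  then show ?thesis unfolding circle_borel_def
    by (intro measurable_restrict_space2) auto
qed

lemma sets_arc_length [simp, measurable_cong]: "sets arc_length = sets circle_borel"
  by (simp add: arc_length_def)

lemma space_arc_length [simp]: "space arc_length = sphere 0 1"
  by (simp add: arc_length_def)

lemma prob_space_arc_length: "prob_space arc_length"
  unfolding arc_length_def by (intro prob_space.prob_space_distr prob_space_angle_measure) measurable

lemma borel_measurable_circle [measurable (raw)]: "f \<in> borel_measurable borel \<Longrightarrow> f \<in> borel_measurable circle_borel"
  unfolding circle_borel_def by (rule measurable_restrict_space1)

lemma continuous_on_imp_measurable_circle: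
  fixes f :: "complex \<Rightarrow> 'b::topological_space"
  shows "continuous_on (sphere 0 1) f \<Longrightarrow> f \<in> borel_measurable circle_borel"
  unfolding circle_borel_def by (rule borel_measurable_continuous_on_restrict)

lemma integrable_circle:
  fixes f :: "complex \<Rightarrow> 'b::{banach, second_countable_topology}"
  assumes "finite_measure \<nu>" and s: "sets \<nu> = sets circle_borel" and f: "continuous_on (sphere 0 1) f"
  shows "integrable \<nu> f"
proof -
  interpret finite_measure \<nu> by fact
  have sp: "space \<nu> = sphere 0 1" using sets_eq_imp_space_eq[OF s] by simp
  have "compact (f ` sphere 0 1)" by (intro compact_continuous_image f) auto
  then obtain B where "\<And>z. z \<in> sphere 0 1 \<Longrightarrow> norm (f z) \<le> B"
    using compact_imp_bounded bounded_iff by (metis imageI)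
  moreover have "f \<in> borel_measurable \<nu>"
    using continuous_on_imp_measurable_circle[OF f] measurable_cong_sets[OF s refl] by blast
  ultimately show ?thesis by (intro integrable_const_bound[where B = B]) (auto simp: sp)
qed

section \<open>Circle averages as Taylor coefficients\<close>

lemma integral_arc_length:
  fixes f :: "complex \<Rightarrow> 'b::{banach, second_countable_topology}"
  shows "continuous_on (sphere 0 1) f \<Longrightarrow> integral\<^sup>L arc_length f = (\<integral>\<theta>. f (cis \<theta>) \<partial>angle_measure)"
  unfolding arc_length_def
  by (intro integral_distr cis_measurable continuous_on_imp_measurable_circle)

text \<open>Passes to the gauge integral, in which contour integrals are expressed.\<close>

lemma integral_angle_measure:
  fixes f :: "real \<Rightarrow> 'b::euclidean_space"
  assumes f: "continuous_on UNIV f"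
  shows "(\<integral>\<theta>. f \<theta> \<partial>angle_measure) = (1 / (2 * pi)) *\<^sub>R integral {0..2 * pi} f"
proof -
  have [measurable]: "f \<in> borel_measurable borel" by (intro borel_measurable_continuous_onI f)
  have "(\<integral>\<theta>. f \<theta> \<partial>angle_measure) = (\<integral>\<theta>. (indicator {0..2 * pi} \<theta> / (2 * pi)) *\<^sub>R f \<theta> \<partial>lborel)"
    unfolding angle_measure_density by (intro integral_density) auto
  also have "\<dots> = (1 / (2 * pi)) *\<^sub>R (LINT \<theta>:{0..2 * pi}|lborel. f \<theta>)"
    unfolding set_lebesgue_integral_def by (subst integral_scaleR_right[symmetric]) (auto intro!: Bochner_Integration.integral_cong)
  also have "(LINT \<theta>:{0..2 * pi}|lborel. f \<theta>) = integral {0..2 * pi} f"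
    by (intro set_borel_integral_eq_integral borel_integrable_atLeastAtMost')
      (rule continuous_on_subset[OF f], simp)
  finally show ?thesis .
qed

text \<open>Cauchy's formula on the boundary circle itself; the factor \<open>\<i> * cis t\<close>
  of the differential cancels one of the k + 1 powers in the denominator.\<close>

lemma circle_taylor_coeff:
  assumes c: "continuous_on (cball 0 1) f" and h: "f holomorphic_on ball 0 1"
  shows "(\<integral>\<theta>. f (cis \<theta>) / cis \<theta> ^ k \<partial>angle_measure) = (deriv ^^ k) f 0 / fact k"
proof -
  have "((\<lambda>u. f u / (u - 0) ^ Suc k) has_contour_integral (2 * pi * \<i> / fact k * (deriv ^^ k) f 0)) (circlepath 0 1)"
    by (rule Cauchy_has_contour_integral_higher_derivative_circlepath[OF c h]) simp
  then have "((\<lambda>t. f (cis t) / (cis t) ^ Suc k * \<i> * cis t) has_integral (2 * pi * \<i> / fact k * (deriv ^^ k) f 0)) {0..2 * pi}"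
    unfolding circlepath_def by (subst (asm) has_contour_integral_part_circlepath_iff) auto
  also have "(\<lambda>t. f (cis t) / (cis t) ^ Suc k * \<i> * cis t) = (\<lambda>t. \<i> * (f (cis t) / cis t ^ k))"
    by (auto simp: fun_eq_iff field_simps)
  finally have 1: "integral {0..2 * pi} (\<lambda>t. \<i> * (f (cis t) / cis t ^ k)) = 2 * pi * \<i> / fact k * (deriv ^^ k) f 0"
    by (rule integral_unique)
  have "continuous_on (sphere 0 1) f" by (rule continuous_on_subset[OF c]) auto
  then have cc: "continuous_on UNIV (\<lambda>t. f (cis t) / cis t ^ k)"
    by (intro continuous_on_divide continuous_on_power continuous_on_cis continuous_on_id
        continuous_on_compose2[of "sphere 0 1" f _ cis]) auto
  have "(\<integral>\<theta>. f (cis \<theta>) / cis \<theta> ^ k \<partial>angle_measure) = (1 / (2 * pi)) *\<^sub>R integral {0..2 * pi} (\<lambda>t. f (cis t) / cis t ^ k)"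
    by (rule integral_angle_measure[OF cc])
  moreover have "\<i> * integral {0..2 * pi} (\<lambda>t. f (cis t) / cis t ^ k) = 2 * pi * \<i> / fact k * (deriv ^^ k) f 0"
    using 1 by (simp only: integral_mult_right)
  then have "integral {0..2 * pi} (\<lambda>t. f (cis t) / cis t ^ k) = 2 * pi / fact k * (deriv ^^ k) f 0"
    by (simp add: field_simps)
  ultimately show ?thesis by (simp add: scaleR_conv_of_real)
qed

lemma has_fps_expansion_poly: "poly p has_fps_expansion fps_of_poly (p :: complex poly)"
proof (induction p)
  case 0
  then show ?case by simp
next
  case (pCons a p)
  have "(\<lambda>x. a + x * poly p x) has_fps_expansion fps_const a + fps_X * fps_of_poly p"
    by (intro fps_expansion_intros pCons)
  moreover have "poly (pCons a p) = (\<lambda>x. a + x * poly p x)" by (simp add: fun_eq_iff)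
  ultimately show ?case by (simp add: fps_of_poly_pCons mult.commute)
qed

text \<open>Coefficients are compared in L' q = q', which avoids composing power series and is
  insensitive to the branch of the logarithm.\<close>

lemma log_poly_taylor_coeff3:
  assumes h: "L holomorphic_on ball 0 1" and e: "\<And>z. z \<in> ball 0 1 \<Longrightarrow> exp (L z) = poly q z"
    and q: "coeff q 0 = 1"
  shows "(deriv ^^ 3) L 0 / fact 3 = log_coeff3 q"
proof -
  define F where "F = fps_expansion L 0"
  have an: "L analytic_on {0}"
    using h by (auto simp: analytic_at intro!: exI[of _ "ball 0 1"])
  have F: "L has_fps_expansion F" unfolding F_def by (rule analytic_at_imp_has_fps_expansion_0[OF an])
  let ?G = "fps_of_poly q"
  have "(\<lambda>z. deriv L z * poly q z) has_fps_expansion fps_deriv F * ?G"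
    by (intro fps_expansion_intros F has_fps_expansion_poly)
  moreover have "deriv (poly q) has_fps_expansion fps_deriv ?G"
    by (intro fps_expansion_intros has_fps_expansion_poly)
  moreover have "eventually (\<lambda>z. deriv L z * poly q z = deriv (poly q) z) (nhds 0)"
    unfolding eventually_nhds
  proof (intro exI conjI ballI)
    fix z :: complex assume z: "z \<in> ball 0 1"
    have "(L has_field_derivative deriv L z) (at z)"
      by (rule holomorphic_derivI[OF h _ z]) simp
    then have "((\<lambda>z. exp (L z)) has_field_derivative exp (L z) * deriv L z) (at z)"
      by (rule DERIV_chain2[OF DERIV_exp])
    then have "(poly q has_field_derivative exp (L z) * deriv L z) (at z)"
      by (rule DERIV_cong_ev[THEN iffD1, OF refl _ refl, rotated])
        (use z e in \<open>auto simp: eventually_nhds intro!: exI[of _ "ball 0 1"]\<close>)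
    then show "deriv L z * poly q z = deriv (poly q) z"
      using e[OF z] by (simp add: DERIV_imp_deriv mult.commute)
  qed auto
  ultimately have "fps_deriv F * ?G = fps_deriv ?G"
    using has_fps_expansion_cong fps_expansion_unique_complex by metis
  then have "(fps_deriv F * ?G) $ n = (fps_deriv ?G) $ n" for n by simp
  from this[of 0] this[of 1] this[of 2]
  have "F $ 1 = coeff q 1" "F $ 1 * coeff q 1 + 2 * F $ 2 = 2 * coeff q 2"
    "F $ 1 * coeff q 2 + 2 * F $ 2 * coeff q 1 + 3 * F $ 3 = 3 * coeff q 3"
    by (simp_all add: fps_mult_nth eval_nat_numeral q)
  then have F1: "F $ 1 = coeff q 1" and F2: "2 * F $ 2 = 2 * coeff q 2 - coeff q 1 * coeff q 1"
    and F3: "3 * F $ 3 = 3 * coeff q 3 - F $ 1 * coeff q 2 - (2 * F $ 2) * coeff q 1"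
    by (simp_all add: algebra_simps)
  have "3 * F $ 3 = 3 * log_coeff3 q"
    unfolding F3 F2 F1 by (simp add: log_coeff3_def algebra_simps power3_eq_cube)
  then have "F $ 3 = log_coeff3 q" by simp
  then show ?thesis by (simp add: F_def fps_expansion_def)
qed

text \<open>On the circle ln |q| = Re L for a logarithm L with L(0) = 0, and the weight is 1 - (z^3
  + z^(-3)) / 2. The averages of L and of z^3 L vanish, being values at 0; the average of z^(-3) L
  is the third Taylor coefficient.\<close>

lemma integral_log_norm_poly:
  assumes q: "coeff q 0 = 1" and nz: "\<And>z. norm z \<le> 1 \<Longrightarrow> poly q z \<noteq> 0"
  shows "(\<integral>\<theta>. (1 - cos (3 * \<theta>)) * ln (norm (poly q (cis \<theta>))) \<partial>angle_measure) = - Re (log_coeff3 q) / 2"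
proof -
  \<comment> \<open>Compactness gives a zero-free disk of radius above 1, so that the logarithm is
    continuous up to the unit circle.\<close>
  have "open {z. poly q z \<noteq> 0}" by (intro open_Collect_neq continuous_intros)
  moreover have "cball 0 1 \<subseteq> {z. poly q z \<noteq> 0}" using nz by auto
  ultimately obtain e where e: "e > 0" "(\<Union>x\<in>cball 0 1. ball x e) \<subseteq> {z. poly q z \<noteq> 0}"
    using compact_subset_open_imp_ball_epsilon_subset[of "cball (0::complex) 1"] by (metis compact_cball)
  have sub: "ball 0 (1 + e) \<subseteq> {z. poly q z \<noteq> 0}"
  proof
    fix z :: complex assume z: "z \<in> ball 0 (1 + e)"
    have "z \<in> (\<Union>x\<in>cball 0 1. ball x e)"
    proof (cases "norm z \<le> 1")
      case True
      then show ?thesis using e(1) by (intro UN_I[of z]) auto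
    next
      \<comment> \<open>Outside the closed disk, the radial projection z / |z| is the nearby point
        of the disk.\<close>
      case False
      then have z0: "z \<noteq> 0" by auto
      have "dist (z / norm z) z = \<bar>norm z - 1\<bar>"
      proof -
        have "z / norm z - z = (z / norm z) * (1 - norm z)"
        proof -
          have "complex_of_real (norm z) \<noteq> 0" using False by auto
          then show ?thesis by (simp add: field_simps)
        qed
        then have "dist (z / norm z) z = norm (1 - complex_of_real (norm z))"
          using z0 by (simp add: dist_norm norm_mult norm_divide)
        also have "\<dots> = \<bar>norm z - 1\<bar>"
          by (metis abs_minus_commute norm_of_real of_real_1 of_real_diff)
        finally show ?thesis .
      qed
      then show ?thesis using False z by (intro UN_I[of "z / norm z"]) (auto simp: norm_divide)
    qed
    then show "z \<in> {z. poly q z \<noteq> 0}" using e(2) by blast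
  qed
  obtain L0 where L0: "L0 holomorphic_on ball 0 (1 + e)" "\<And>z. z \<in> ball 0 (1 + e) \<Longrightarrow> poly q z = exp (L0 z)"
    by (rule holomorphic_logarithm_exists[of "ball 0 (1 + e)" "poly q" 0])
      (use sub e(1) in \<open>auto intro!: holomorphic_intros\<close>)
  \<comment> \<open>Fixes the branch with L(0) = 0.\<close>
  define L where "L z = L0 z - L0 0" for z
  have "exp (L0 0) = 1" using L0(2)[of 0] e(1) q by (simp add: poly_0_coeff_0)
  then have L: "L 0 = 0" "\<And>z. z \<in> ball 0 (1 + e) \<Longrightarrow> exp (L z) = poly q z"
    using L0(2) by (auto simp: L_def exp_diff)
  have h: "L holomorphic_on ball 0 (1 + e)" unfolding L_def by (intro holomorphic_intros L0)
  have h1: "L holomorphic_on ball 0 1" by (rule holomorphic_on_subset[OF h]) (use e(1) in auto)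
  have c1: "continuous_on (cball 0 1) L"
    by (rule continuous_on_subset[OF holomorphic_on_imp_continuous_on[OF h]]) (use e(1) in auto)
  have cs: "continuous_on (sphere 0 1) L" by (rule continuous_on_subset[OF c1]) auto
  interpret prob_space angle_measure by (rule prob_space_angle_measure)
  have int: "integrable angle_measure (\<lambda>\<theta>. f (cis \<theta>))" if "continuous_on (sphere 0 1) f" for f :: "complex \<Rightarrow> complex"
    using integrable_circle[OF prob_space.finite_measure[OF prob_space_arc_length] sets_arc_length that]
    unfolding arc_length_def by (rule integrable_distr[rotated]) measurable
  have i0: "(\<integral>\<theta>. L (cis \<theta>) \<partial>angle_measure) = 0"
    using circle_taylor_coeff[OF c1 h1, of 0] L by simp
  have i3: "(\<integral>\<theta>. L (cis \<theta>) / cis \<theta> ^ 3 \<partial>angle_measure) = log_coeff3 q"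
    unfolding circle_taylor_coeff[OF c1 h1, of 3]
    by (rule log_poly_taylor_coeff3[OF h1 _ q]) (use e(1) L in auto)
  have im: "(\<integral>\<theta>. L (cis \<theta>) * cis \<theta> ^ 3 \<partial>angle_measure) = 0"
  proof -
    have "continuous_on (cball 0 1) (\<lambda>z. L z * z ^ 3)" by (intro continuous_intros c1)
    moreover have "(\<lambda>z. L z * z ^ 3) holomorphic_on ball 0 1" by (intro holomorphic_intros h1)
    ultimately show ?thesis using circle_taylor_coeff[of "\<lambda>z. L z * z ^ 3" 0] by simp
  qed
  have eq: "(1 - cos (3 * \<theta>)) * ln (norm (poly q (cis \<theta>))) = Re (L (cis \<theta>) - (L (cis \<theta>) * cis \<theta> ^ 3 + L (cis \<theta>) / cis \<theta> ^ 3) / 2)" for \<theta>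
  proof -
    have "ln (norm (poly q (cis \<theta>))) = Re (L (cis \<theta>))"
    proof -
      have "poly q (cis \<theta>) = exp (L (cis \<theta>))" using L(2)[of "cis \<theta>"] e(1) by simp
      then show ?thesis by simp
    qed
    moreover have "L (cis \<theta>) * cis \<theta> ^ 3 + L (cis \<theta>) / cis \<theta> ^ 3 = of_real (2 * cos (3 * \<theta>)) * L (cis \<theta>)"
    proof -
      have "cis \<theta> ^ 3 = cis (3 * \<theta>)" using Complex.DeMoivre[of \<theta> 3] by simp
      moreover have "L (cis \<theta>) / cis (3 * \<theta>) = L (cis \<theta>) * cis (- (3 * \<theta>))"
        by (simp only: divide_inverse cis_inverse)
      moreover have "cis (3 * \<theta>) + cis (- (3 * \<theta>)) = of_real (2 * cos (3 * \<theta>))"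
        by (simp add: complex_eq_iff)
      ultimately show ?thesis by (metis distrib_left mult.commute)
    qed
    ultimately show ?thesis by (simp add: algebra_simps)
  qed
  have M: "integrable angle_measure (\<lambda>\<theta>. L (cis \<theta>))" "integrable angle_measure (\<lambda>\<theta>. L (cis \<theta>) * cis \<theta> ^ 3)"
    "integrable angle_measure (\<lambda>\<theta>. L (cis \<theta>) / cis \<theta> ^ 3)"
    by (rule int[OF cs], rule int[of "\<lambda>z. L z * z ^ 3"], intro continuous_intros cs,
        rule int[of "\<lambda>z. L z / z ^ 3"], intro continuous_intros cs) auto
  have M4: "integrable angle_measure (\<lambda>\<theta>. L (cis \<theta>) - (L (cis \<theta>) * cis \<theta> ^ 3 + L (cis \<theta>) / cis \<theta> ^ 3) / 2)"
    by (intro Bochner_Integration.integrable_diff integrable_divide Bochner_Integration.integrable_add M)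
  have "(\<integral>\<theta>. (1 - cos (3 * \<theta>)) * ln (norm (poly q (cis \<theta>))) \<partial>angle_measure)
      = Re (\<integral>\<theta>. L (cis \<theta>) - (L (cis \<theta>) * cis \<theta> ^ 3 + L (cis \<theta>) / cis \<theta> ^ 3) / 2 \<partial>angle_measure)"
    unfolding eq by (rule integral_Re[OF M4])
  also have "(\<integral>\<theta>. L (cis \<theta>) - (L (cis \<theta>) * cis \<theta> ^ 3 + L (cis \<theta>) / cis \<theta> ^ 3) / 2 \<partial>angle_measure)
     = 0 - (0 + log_coeff3 q) / 2"
    by (simp add: Bochner_Integration.integral_diff integrable_divide Bochner_Integration.integrable_add M i0 i3 im)
  finally show ?thesis by simp
qed

section \<open>Orthogonality and moments\<close>

text \<open>The inner product with z^k, with an integer exponent so that the reflection of k to n -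
  k is always meaningful, and for any finite measure, since it is also used for the approximating
  ones.\<close>

definition circle_moment :: "complex measure \<Rightarrow> int \<Rightarrow> complex poly \<Rightarrow> complex" where
  "circle_moment \<nu> k p = (\<integral>z. z powi (- k) * poly p z \<partial>\<nu>)"

definition orthogonal_below :: "complex measure \<Rightarrow> nat \<Rightarrow> complex poly \<Rightarrow> bool" where
  "orthogonal_below \<nu> n p \<longleftrightarrow> (\<forall>k. 0 \<le> k \<and> k < int n \<longrightarrow> circle_moment \<nu> k p = 0)"

text \<open>The square of the norm of the n-th monic orthogonal polynomial, by
  \<open>verblunsky_norm\<close>.\<close>

definition szego_norm :: "(nat \<Rightarrow> complex) \<Rightarrow> nat \<Rightarrow> real" where
  "szego_norm \<alpha> n = (\<Prod>j<n. 1 - (norm (\<alpha> j))\<^sup>2)"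

lemma cnj_circle:
  assumes "norm z = 1"
  shows "cnj z = inverse z"
  using assms by (metis complex_norm_square inverse_unique mult.commute of_real_1 one_power2)

context
  fixes \<nu> :: "complex measure"
  assumes fin: "finite_measure \<nu>" and sets: "sets \<nu> = sets circle_borel"
begin

lemma norm_circle: "z \<in> space \<nu> \<Longrightarrow> norm z = 1"
  using sets_eq_imp_space_eq[OF sets] by simp

lemma integrable_moment: "integrable \<nu> (\<lambda>z. z powi k * poly p z)"
  by (intro integrable_circle[OF fin sets] continuous_intros) auto

lemma circle_moment_linear:
  "circle_moment \<nu> k (p + q) = circle_moment \<nu> k p + circle_moment \<nu> k q"
  "circle_moment \<nu> k (p - q) = circle_moment \<nu> k p - circle_moment \<nu> k q"
  "circle_moment \<nu> k (smult c p) = c * circle_moment \<nu> k p"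
proof -
  note [simp] = integrable_moment
  show "circle_moment \<nu> k (p + q) = circle_moment \<nu> k p + circle_moment \<nu> k q"
    "circle_moment \<nu> k (p - q) = circle_moment \<nu> k p - circle_moment \<nu> k q"
    by (simp_all add: circle_moment_def ring_distribs)
  show "circle_moment \<nu> k (smult c p) = c * circle_moment \<nu> k p"
    unfolding circle_moment_def integral_mult_right_zero[symmetric]
    by (intro Bochner_Integration.integral_cong) (auto simp: mult.left_commute)
qed

lemma circle_moment_pCons: "circle_moment \<nu> (k + 1) (pCons 0 p) = circle_moment \<nu> k p"
  unfolding circle_moment_def
proof (intro Bochner_Integration.integral_cong refl)
  fix z assume "z \<in> space \<nu>"
  then have "z \<noteq> 0" using norm_circle by fastforce
  then have "z powi (- (k + 1)) * z = z powi (- k)"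
    using power_int_add_1[of z "- (k + 1)"] by simp
  then show "z powi (- (k + 1)) * poly (pCons 0 p) z = z powi (- k) * poly p z"
    by (simp flip: mult.assoc)
qed

text \<open>Reversal conjugates and reflects moments. If \<open>szego_poly\<close> is orthogonal to
  the powers 0, ..., n - 1, then \<open>szego_rev\<close> is orthogonal to 1, ..., n.\<close>

lemma circle_moment_szego_rev:
  "circle_moment \<nu> k (szego_rev \<alpha> n) = cnj (circle_moment \<nu> (int n - k) (szego_poly \<alpha> n))"
  unfolding circle_moment_def Bochner_Integration.integral_cnj[symmetric]
proof (intro Bochner_Integration.integral_cong refl)
  fix z assume "z \<in> space \<nu>"
  then have z: "norm z = 1" by (rule norm_circle)
  then have "z \<noteq> 0" by auto
  have "cnj (z powi (- (int n - k))) = z powi (int n - k)"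
    by (simp add: complex_cnj_power_int cnj_circle[OF z] power_int_inverse flip: power_int_minus)
  also have "\<dots> = z powi (- k) * z ^ n"
    using power_int_add[of z "- k" "int n"] \<open>z \<noteq> 0\<close> by simp
  finally show "z powi (- k) * poly (szego_rev \<alpha> n) z = cnj (z powi (- (int n - k)) * poly (szego_poly \<alpha> n) z)"
    by (simp add: szego_rev_on_circle[OF z] mult.assoc)
qed

text \<open>The inverse recursion: the two recursion equations, of determinant proportional to 1 -
  |\<alpha>|^2, are solved for z times \<open>szego_poly\<close>. It lets orthogonality descend to
  smaller degrees.\<close>

lemma szego_backward:
  "(1 - \<alpha> n * cnj (\<alpha> n)) * circle_moment \<nu> k (szego_poly \<alpha> n) =
     circle_moment \<nu> (k + 1) (szego_poly \<alpha> (Suc n)) + cnj (\<alpha> n) * cnj (circle_moment \<nu> (int n - k) (szego_poly \<alpha> (Suc n)))"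
proof -
  have "smult (1 - \<alpha> n * cnj (\<alpha> n)) (pCons 0 (szego_poly \<alpha> n)) =
      szego_poly \<alpha> (Suc n) + smult (cnj (\<alpha> n)) (szego_rev \<alpha> (Suc n))"
    by (simp add: smult_diff_right smult_diff_left mult.commute)
  then have "circle_moment \<nu> (k + 1) (smult (1 - \<alpha> n * cnj (\<alpha> n)) (pCons 0 (szego_poly \<alpha> n))) =
      circle_moment \<nu> (k + 1) (szego_poly \<alpha> (Suc n) + smult (cnj (\<alpha> n)) (szego_rev \<alpha> (Suc n)))"
    by simp
  then show ?thesis
    unfolding circle_moment_linear circle_moment_pCons circle_moment_szego_rev by simp
qed

lemma szego_backward_norm:
  assumes "orthogonal_below \<nu> (Suc n) (szego_poly \<alpha> (Suc n))"
  shows "(1 - \<alpha> n * cnj (\<alpha> n)) * circle_moment \<nu> (int n) (szego_poly \<alpha> n) = circle_moment \<nu> (int (Suc n)) (szego_poly \<alpha> (Suc n))"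
  using assms szego_backward[of \<alpha> n "int n"] by (simp add: orthogonal_below_def add.commute)

text \<open>For 0 \<le> k < n both k + 1 and n - k lie between 1 and n, so both terms of
  \<open>szego_backward\<close> vanish.\<close>

lemma szego_backward_orthogonal:
  assumes "orthogonal_below \<nu> (Suc n) (szego_poly \<alpha> (Suc n))" and a: "norm (\<alpha> n) < 1"
  shows "orthogonal_below \<nu> n (szego_poly \<alpha> n)"
  unfolding orthogonal_below_def
proof (intro allI impI)
  fix k assume k: "0 \<le> k \<and> k < int n"
  have "(norm (\<alpha> n))\<^sup>2 \<noteq> 1" using a abs_square_less_1[of "norm (\<alpha> n)"] by simp
  then have "1 - \<alpha> n * cnj (\<alpha> n) \<noteq> 0" using complex_norm_square[of "\<alpha> n"]
    by (metis eq_iff_diff_eq_0 of_real_eq_1_iff)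
  then show "circle_moment \<nu> k (szego_poly \<alpha> n) = 0"
    using assms k szego_backward[of \<alpha> n k] by (simp add: orthogonal_below_def)
qed

text \<open>Downward induction: each step divides by the nonzero 1 - |\<alpha>|^2. For the
  approximating measure only degree n is accessible directly, and this supplies the smaller
  degrees.\<close>

lemma szego_norm_circle_moment:
  assumes "\<And>j. j < n \<Longrightarrow> norm (\<alpha> j) < 1" and "orthogonal_below \<nu> n (szego_poly \<alpha> n)"
    and "circle_moment \<nu> (int n) (szego_poly \<alpha> n) = szego_norm \<alpha> n" and "m \<le> n"
  shows "orthogonal_below \<nu> m (szego_poly \<alpha> m) \<and> circle_moment \<nu> (int m) (szego_poly \<alpha> m) = szego_norm \<alpha> m"
  using assms(4)
proof (induction rule: inc_induct)
  case (step m)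
  have a: "norm (\<alpha> m) < 1" using assms(1) step by simp
  then have "(norm (\<alpha> m))\<^sup>2 \<noteq> 1" using abs_square_less_1[of "norm (\<alpha> m)"] by simp
  then have nz: "complex_of_real (1 - (norm (\<alpha> m))\<^sup>2) \<noteq> 0" by (metis eq_iff_diff_eq_0 of_real_eq_0_iff)
  have "complex_of_real (1 - (norm (\<alpha> m))\<^sup>2) * circle_moment \<nu> (int m) (szego_poly \<alpha> m) =
      complex_of_real (1 - (norm (\<alpha> m))\<^sup>2) * szego_norm \<alpha> m"
    using szego_backward_norm[of m \<alpha>] step by (simp add: szego_norm_def mult.commute complex_norm_square del: szego_poly.simps of_real_power)
  then show ?case using szego_backward_orthogonal[of m \<alpha>] step a nz by (simp del: of_real_diff)
next
  case base
  show ?case using assms(2,3) by (rule conjI)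
qed

end

text \<open>The polynomials of the recursion are monic of consecutive degrees, hence a triangular
  basis.\<close>

lemma circle_moments_eq:
  assumes 1: "finite_measure \<nu>" "sets \<nu> = sets circle_borel" and 2: "finite_measure \<nu>'" "sets \<nu>' = sets circle_borel"
    and eq: "\<And>m. m < n \<Longrightarrow> circle_moment \<nu> 0 (szego_poly \<alpha> m) = circle_moment \<nu>' 0 (szego_poly \<alpha> m)"
    and p: "\<forall>k\<ge>n. coeff p k = 0"
  shows "circle_moment \<nu> 0 p = circle_moment \<nu>' 0 p"
  using eq p
proof (induction n arbitrary: p)
  case 0
  then have "p = 0" by (simp add: poly_eq_iff)
  then show ?case by (simp add: circle_moment_def)
next
  case (Suc n)
  let ?r = "p - smult (coeff p n) (szego_poly \<alpha> n)"
  have r: "\<forall>k\<ge>n. coeff ?r k = 0"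
  proof (intro allI impI)
    fix k assume "n \<le> k"
    then show "coeff ?r k = 0"
      using Suc.prems(2) coeff_szego_poly_top[of \<alpha> n] coeff_eq_0[of "szego_poly \<alpha> n" k] degree_szego_poly[of \<alpha> n]
      by (cases "k = n") auto
  qed
  have IH: "circle_moment \<nu> 0 ?r = circle_moment \<nu>' 0 ?r"
    by (rule Suc.IH[OF _ r]) (rule Suc.prems(1), simp)
  have "circle_moment \<nu> 0 (szego_poly \<alpha> n) = circle_moment \<nu>' 0 (szego_poly \<alpha> n)"
    by (rule Suc.prems(1)) simp
  with IH show ?case
    unfolding circle_moment_linear[OF 1] circle_moment_linear[OF 2] by simp
qed

section \<open>Szego's theorem: the orthogonal polynomials satisfy the recursion\<close>

lemma finite_measure_circle:
  assumes "nontrivial_circle_prob \<mu>"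
  shows "finite_measure \<mu>" "sets \<mu> = sets circle_borel" "space \<mu> = sphere 0 1"
  using nontrivial_circle_probD[OF assms] by (auto intro: prob_space.finite_measure)

lemma L2_inner_monom_eq:
  assumes "nontrivial_circle_prob \<mu>"
  shows "L2_inner \<mu> (monom 1 k) p = circle_moment \<mu> (int k) p"
  unfolding L2_inner_def circle_moment_def
proof (intro Bochner_Integration.integral_cong refl)
  fix z assume "z \<in> space \<mu>"
  then have "cnj z = inverse z"
    using cnj_circle finite_measure_circle(3)[OF assms] by simp
  then show "cnj (poly (monom 1 k) z) * poly p z = z powi (- int k) * poly p z"
    by (simp add: poly_monom power_int_minus power_inverse)
qed

lemma is_monic_OP_iff:
  assumes "nontrivial_circle_prob \<mu>"
  shows "is_monic_OP \<mu> n p \<longleftrightarrow> degree p = n \<and> lead_coeff p = 1 \<and> orthogonal_below \<mu> n p"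
proof -
  have "(\<forall>k<n. circle_moment \<mu> (int k) p = 0) \<longleftrightarrow> orthogonal_below \<mu> n p"
    unfolding orthogonal_below_def by (metis nonneg_int_cases of_nat_0_le_iff of_nat_less_iff)
  then show ?thesis by (simp add: is_monic_OP_def L2_inner_monom_eq[OF assms])
qed

lemma L2_inner_szego_poly:
  assumes mu: "nontrivial_circle_prob \<mu>" and o: "orthogonal_below \<mu> n (szego_poly \<alpha> n)"
  shows "L2_inner \<mu> (szego_poly \<alpha> n) (szego_poly \<alpha> n) = circle_moment \<mu> (int n) (szego_poly \<alpha> n)"
proof -
  let ?p = "szego_poly \<alpha> n"
  have "\<forall>k\<ge>n. coeff (?p - monom 1 n) k = 0"
  proof (intro allI impI)
    fix k assume "n \<le> k"
    then show "coeff (?p - monom 1 n) k = 0"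
      using coeff_szego_poly_top[of \<alpha> n] coeff_eq_0[of ?p k] degree_szego_poly[of \<alpha> n]
      by (cases "k = n") auto
  qed
  moreover have "\<forall>k<n. L2_inner \<mu> (monom 1 k) ?p = 0"
    using o by (simp add: L2_inner_monom_eq[OF mu] orthogonal_below_def)
  ultimately have "L2_inner \<mu> (?p - monom 1 n) ?p = 0" by (rule L2_inner_low_degree[OF mu])
  then show ?thesis by (simp add: L2_inner_linear[OF mu] L2_inner_monom_eq[OF mu])
qed

text \<open>A combination of z times the n-th polynomial and the reversed one is monic of degree n +
  1 and orthogonal to the powers 1, ..., n for any c; one choice of c adds the power 0. By
  uniqueness it is the next orthogonal polynomial, and its value -c at 0 identifies c with the
  conjugate of the Verblunsky coefficient.\<close>

lemma is_monic_OP_szego_poly: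
  assumes mu: "nontrivial_circle_prob \<mu>"
  shows "is_monic_OP \<mu> n (szego_poly (verblunsky \<mu>) n)"
proof (induction n)
  case 0
  then show ?case by (simp add: is_monic_OP_def)
next
  case (Suc n)
  let ?\<alpha> = "verblunsky \<mu>"
  let ?P = "szego_poly ?\<alpha> n" and ?Q = "szego_rev ?\<alpha> n"
  note fm = finite_measure_circle(1,2)[OF mu]
  have o: "orthogonal_below \<mu> n ?P" using Suc is_monic_OP_iff[OF mu] by blast
  have "?P \<noteq> 0" using coeff_szego_poly_top[of ?\<alpha> n] by auto
  then have nz: "circle_moment \<mu> (int n) ?P \<noteq> 0"
    using L2_inner_eq_0_imp[OF mu, of ?P] L2_inner_szego_poly[OF mu o] by auto
  \<comment> \<open>The denominator is the conjugate of the squared norm of the n-th polynomial,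
    nonzero by the infinite support.\<close>
  define c where "c = circle_moment \<mu> 0 (pCons 0 ?P) / circle_moment \<mu> 0 ?Q"
  define R where "R = pCons 0 ?P - smult c ?Q"
  have Q0: "coeff ?Q (Suc n) = 0" "degree ?Q \<le> n"
    using degree_szego_le[of ?\<alpha> n] by (auto intro: coeff_eq_0)
  have "degree (pCons 0 ?P) = Suc n" using \<open>?P \<noteq> 0\<close> by (simp add: degree_szego_poly)
  then have "degree R \<le> Suc n" unfolding R_def
    using Q0(2) by (intro degree_diff_le) (auto intro: order_trans[OF degree_smult_le])
  moreover have cR: "coeff R (Suc n) = 1"
    by (simp add: R_def Q0 coeff_szego_poly_top)
  ultimately have dR: "degree R = Suc n" by (metis le_antisym le_degree one_neq_zero)
  have "orthogonal_below \<mu> (Suc n) R"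
    unfolding orthogonal_below_def
  proof (intro allI impI)
    fix k assume k: "0 \<le> k \<and> k < int (Suc n)"
    show "circle_moment \<mu> k R = 0"
    proof (cases "k = 0")
      case True
      have "circle_moment \<mu> 0 ?Q \<noteq> 0"
        using nz by (simp add: circle_moment_szego_rev[OF fm])
      then show ?thesis by (simp add: True R_def circle_moment_linear[OF fm] c_def)
    next
      case False
      then have "circle_moment \<mu> k (pCons 0 ?P) = 0" "circle_moment \<mu> k ?Q = 0"
        using circle_moment_pCons[OF fm, of "k - 1" ?P] o k
        by (auto simp: circle_moment_szego_rev[OF fm] orthogonal_below_def)
      then show ?thesis by (simp add: R_def circle_moment_linear[OF fm])
    qed
  qed
  with dR cR have R: "is_monic_OP \<mu> (Suc n) R" by (simp add: is_monic_OP_iff[OF mu])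
  then have "monic_OP \<mu> (Suc n) = R"
    unfolding monic_OP_def using is_monic_OP_ex1[OF mu] by (metis the1_equality)
  then have "?\<alpha> n = cnj c"
    by (simp add: verblunsky_def R_def poly_0_coeff_0 coeff_szego_rev_0)
  then have "szego_poly ?\<alpha> (Suc n) = R" by (simp add: R_def)
  with R show ?case by simp
qed

text \<open>The squared norms are positive and consecutive ones differ by the factor 1 -
  |\<alpha>|^2, so this factor is positive; the product formula follows by iteration.\<close>

lemma verblunsky_norm:
  assumes mu: "nontrivial_circle_prob \<mu>"
  shows "norm (verblunsky \<mu> n) < 1"
    and "(\<integral>z. (norm (poly (szego_poly (verblunsky \<mu>) n) z))\<^sup>2 \<partial>\<mu>) = szego_norm (verblunsky \<mu>) n"
proof -
  let ?\<alpha> = "verblunsky \<mu>"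
  note fm = finite_measure_circle(1,2)[OF mu]
  define h where "h n = (\<integral>z. (norm (poly (szego_poly ?\<alpha> n) z))\<^sup>2 \<partial>\<mu>)" for n
  have o: "orthogonal_below \<mu> n (szego_poly ?\<alpha> n)" for n
    using is_monic_OP_szego_poly[OF mu] is_monic_OP_iff[OF mu] by blast
  have L: "L2_inner \<mu> p p = of_real (\<integral>z. (norm (poly p z))\<^sup>2 \<partial>\<mu>)" for p
    unfolding L2_inner_def integral_complex_of_real[symmetric]
    by (intro Bochner_Integration.integral_cong refl) (metis complex_norm_square mult.commute)
  have hm: "circle_moment \<mu> (int n) (szego_poly ?\<alpha> n) = h n" for n
    using L2_inner_szego_poly[OF mu o, of n] L[of "szego_poly ?\<alpha> n"] by (simp add: h_def)
  have hS: "h (Suc n) = (1 - (norm (?\<alpha> n))\<^sup>2) * h n" for n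
  proof -
    have "complex_of_real ((1 - (norm (?\<alpha> n))\<^sup>2) * h n) = complex_of_real (h (Suc n))"
      using szego_backward_norm[OF fm o[of "Suc n"]] unfolding hm
      by (simp add: complex_norm_square del: of_real_power)
    then show ?thesis by (simp only: of_real_eq_iff)
  qed
  have pos: "0 < h n" for n
  proof -
    have "szego_poly ?\<alpha> n \<noteq> 0" using coeff_szego_poly_top[of ?\<alpha> n] by auto
    then have "L2_inner \<mu> (szego_poly ?\<alpha> n) (szego_poly ?\<alpha> n) \<noteq> 0" using L2_inner_eq_0_imp[OF mu] by blast
    then have "h n \<noteq> 0" by (auto simp: h_def L)
    moreover have "0 \<le> h n" unfolding h_def by simp
    ultimately show ?thesis by simp
  qed
  have "0 < 1 - (norm (?\<alpha> n))\<^sup>2" using hS[of n] pos[of n] pos[of "Suc n"] by (simp add: zero_less_mult_iff)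
  then show "norm (?\<alpha> n) < 1" by (simp add: abs_square_less_1)
  have "h 0 = 1"
    unfolding h_def using nontrivial_circle_probD(1)[OF mu] by (simp add: prob_space.prob_space)
  then have "h n = szego_norm ?\<alpha> n" by (induction n) (simp_all add: hS szego_norm_def)
  then show "(\<integral>z. (norm (poly (szego_poly ?\<alpha> n) z))\<^sup>2 \<partial>\<mu>) = szego_norm ?\<alpha> n" by (simp add: h_def)
qed

section \<open>Bernstein-Szego approximation\<close>

text \<open>The reversed polynomial has the same modulus on the circle as the orthogonal one, but no
  zeros in the closed disk, which makes the integrands below analytic.\<close>

definition bs_weight :: "(nat \<Rightarrow> complex) \<Rightarrow> nat \<Rightarrow> complex \<Rightarrow> real" where
  "bs_weight \<alpha> n z = szego_norm \<alpha> n / (norm (poly (szego_rev \<alpha> n) z))\<^sup>2"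

definition bs_measure :: "(nat \<Rightarrow> complex) \<Rightarrow> nat \<Rightarrow> complex measure" where
  "bs_measure \<alpha> n = density arc_length (\<lambda>z. ennreal (bs_weight \<alpha> n z))"

context
  fixes \<alpha> :: "nat \<Rightarrow> complex"
  assumes a: "\<And>n. norm (\<alpha> n) < 1"
begin

lemma szego_norm_pos: "0 < szego_norm \<alpha> n"
  unfolding szego_norm_def using a by (intro prod_pos) (auto simp: abs_square_less_1)

lemma szego_rev_nonzero: "norm z \<le> 1 \<Longrightarrow> poly (szego_rev \<alpha> n) z \<noteq> 0"
  using szego_poly_disk[of \<alpha>, OF a] by blast

lemma bs_weight_pos: "norm z = 1 \<Longrightarrow> 0 < bs_weight \<alpha> n z"
  using szego_norm_pos[of n] szego_rev_nonzero[of z n] by (simp add: bs_weight_def)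

lemma continuous_on_bs_weight: "continuous_on (sphere 0 1) (bs_weight \<alpha> n)"
  unfolding bs_weight_def using szego_rev_nonzero by (intro continuous_intros) auto

lemma sets_bs_measure [simp]: "sets (bs_measure \<alpha> n) = sets circle_borel"
  by (simp add: bs_measure_def)

lemma measurable_bs_weight: "bs_weight \<alpha> n \<in> borel_measurable arc_length"
  using continuous_on_imp_measurable_circle[OF continuous_on_bs_weight]
  by (simp add: measurable_cong_sets[OF sets_arc_length refl])

lemma finite_measure_bs_measure: "finite_measure (bs_measure \<alpha> n)"
proof (rule finite_measureI)
  have "integrable arc_length (bs_weight \<alpha> n)"
    by (intro integrable_circle[OF prob_space.finite_measure[OF prob_space_arc_length]] continuous_on_bs_weight) simp
  then have "(\<integral>\<^sup>+z. ennreal (norm (bs_weight \<alpha> n z)) \<partial>arc_length) < \<infinity>"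
    by (simp add: integrable_iff_bounded)
  moreover have "(\<integral>\<^sup>+z. ennreal (bs_weight \<alpha> n z) \<partial>arc_length) \<le> (\<integral>\<^sup>+z. ennreal (norm (bs_weight \<alpha> n z)) \<partial>arc_length)"
    by (intro nn_integral_mono ennreal_leI) simp
  moreover have "emeasure (bs_measure \<alpha> n) (space (bs_measure \<alpha> n)) = (\<integral>\<^sup>+z. ennreal (bs_weight \<alpha> n z) \<partial>arc_length)"
    unfolding bs_measure_def space_density using measurable_bs_weight
    by (subst emeasure_density) (auto intro!: nn_integral_cong simp flip: space_circle_borel)
  ultimately show "emeasure (bs_measure \<alpha> n) (space (bs_measure \<alpha> n)) \<noteq> \<infinity>"
    by (metis infinity_ennreal_def leD order.strict_trans1 order_refl)
qed

lemma integral_bs_measure: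
  fixes f :: "complex \<Rightarrow> 'b::{banach, second_countable_topology}"
  assumes f: "continuous_on (sphere 0 1) f"
  shows "integral\<^sup>L (bs_measure \<alpha> n) f = (\<integral>z. bs_weight \<alpha> n z *\<^sub>R f z \<partial>arc_length)"
  unfolding bs_measure_def
proof (intro integral_density measurable_bs_weight)
  show "f \<in> borel_measurable arc_length"
    using continuous_on_imp_measurable_circle[OF f] by (simp add: measurable_cong_sets[OF sets_arc_length refl])
  show "AE z in arc_length. 0 \<le> bs_weight \<alpha> n z"
    using bs_weight_pos by (intro AE_I2) (auto intro: less_imp_le)
qed

text \<open>On the circle, weight times polynomial equals the constant \<open>szego_norm\<close>
  times z^n divided by the reversed polynomial. The integrand is thus analytic in the disk, and its
  average is its value at 0.\<close>

lemma circle_moment_bs_measure: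
  assumes "k \<le> n"
  shows "circle_moment (bs_measure \<alpha> n) (int k) (szego_poly \<alpha> n) = (if k = n then szego_norm \<alpha> n else 0)"
proof -
  let ?P = "szego_poly \<alpha> n" and ?Q = "szego_rev \<alpha> n"
  define f where "f z = szego_norm \<alpha> n * z ^ (n - k) / poly ?Q z" for z :: complex
  have "continuous_on (sphere 0 1) (\<lambda>z. z powi (- int k) * poly ?P z)"
    by (intro continuous_intros) auto
  then have "circle_moment (bs_measure \<alpha> n) (int k) ?P = (\<integral>z. bs_weight \<alpha> n z *\<^sub>R (z powi (- int k) * poly ?P z) \<partial>arc_length)"
    unfolding circle_moment_def by (rule integral_bs_measure)
  also have "\<dots> = (\<integral>z. f z \<partial>arc_length)"
  proof (intro Bochner_Integration.integral_cong refl)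
    fix z assume "z \<in> space arc_length"
    then have z: "norm z = 1" by simp
    then have z0: "z \<noteq> 0" by auto
    have Q: "poly ?Q z = z ^ n * cnj (poly ?P z)" by (rule szego_rev_on_circle[OF z])
    have Q0: "poly ?Q z \<noteq> 0" using szego_rev_nonzero[of z n] z by simp
    then have P0: "poly ?P z \<noteq> 0" using Q by auto
    have "of_real ((norm (poly ?Q z))\<^sup>2) = poly ?P z * cnj (poly ?P z)"
      unfolding norm_szego_on_circle[OF z, symmetric] by (rule complex_norm_square)
    then have "of_real (bs_weight \<alpha> n z) * poly ?P z = szego_norm \<alpha> n / cnj (poly ?P z)"
      using P0 by (simp add: bs_weight_def del: of_real_power)
    also have "\<dots> = szego_norm \<alpha> n * z ^ n / poly ?Q z"
      using P0 z0 by (simp add: Q)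
    finally have "bs_weight \<alpha> n z *\<^sub>R (z powi (- int k) * poly ?P z) = z powi (- int k) * (szego_norm \<alpha> n * z ^ n / poly ?Q z)"
      by (simp add: scaleR_conv_of_real mult.left_commute)
    moreover have "z powi (- int k) * z ^ n = z ^ (n - k)"
      using power_int_add[of z "- int k" "int n"] z0 assms by (simp flip: power_int_of_nat add: of_nat_diff)
    ultimately show "bs_weight \<alpha> n z *\<^sub>R (z powi (- int k) * poly ?P z) = f z"
      by (simp add: f_def mult.left_commute)
  qed
  also have "\<dots> = (\<integral>\<theta>. f (cis \<theta>) / cis \<theta> ^ 0 \<partial>angle_measure)"
  proof (subst integral_arc_length)
    show "continuous_on (sphere 0 1) f"
      unfolding f_def using szego_rev_nonzero by (intro continuous_intros) auto
  qed simp
  also have "\<dots> = (deriv ^^ 0) f 0 / fact 0"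
    by (rule circle_taylor_coeff; unfold f_def; intro continuous_intros holomorphic_intros)
      (use szego_rev_nonzero in auto)
  also have "\<dots> = (if k = n then szego_norm \<alpha> n else 0)"
    using assms by (simp add: f_def poly_0_coeff_0 coeff_szego_rev_0)
  finally show ?thesis .
qed

end

text \<open>Orthogonality in degree n descends to every m \<le> n; the case m = 0 says that the
  approximating measure has mass 1.\<close>

lemma circle_moment_0_szego_poly:
  assumes a: "\<And>n. norm (\<alpha> n) < 1" and "m \<le> n"
  shows "circle_moment (bs_measure \<alpha> n) 0 (szego_poly \<alpha> m) = (if m = 0 then 1 else 0)"
proof -
  have "orthogonal_below (bs_measure \<alpha> n) n (szego_poly \<alpha> n)"
    unfolding orthogonal_below_def
  proof (intro allI impI)
    fix k assume "0 \<le> k \<and> k < int n"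
    then have "nat k \<le> n" "nat k \<noteq> n" "int (nat k) = k" by auto
    then show "circle_moment (bs_measure \<alpha> n) k (szego_poly \<alpha> n) = 0"
      using circle_moment_bs_measure[of \<alpha>, OF a, of "nat k" n] by simp
  qed
  moreover have "circle_moment (bs_measure \<alpha> n) (int n) (szego_poly \<alpha> n) = szego_norm \<alpha> n"
    using circle_moment_bs_measure[of \<alpha>, OF a, of n n] by simp
  ultimately have "orthogonal_below (bs_measure \<alpha> n) m (szego_poly \<alpha> m) \<and>
      circle_moment (bs_measure \<alpha> n) (int m) (szego_poly \<alpha> m) = szego_norm \<alpha> m"
    by (intro szego_norm_circle_moment[OF finite_measure_bs_measure[of \<alpha>, OF a] sets_bs_measure[of \<alpha>, OF a], of n \<alpha> n])
      (use a assms(2) in auto)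
  then show ?thesis by (auto simp: orthogonal_below_def szego_norm_def)
qed

lemma circle_moment_bs_measure_eq:
  assumes mu: "nontrivial_circle_prob \<mu>" and p: "degree p \<le> n"
  shows "circle_moment (bs_measure (verblunsky \<mu>) n) 0 p = circle_moment \<mu> 0 p"
proof (rule circle_moments_eq)
  let ?\<alpha> = "verblunsky \<mu>"
  note a = verblunsky_norm(1)[OF mu]
  show "finite_measure (bs_measure ?\<alpha> n)" "sets (bs_measure ?\<alpha> n) = sets circle_borel"
    by (rule finite_measure_bs_measure[of ?\<alpha>, OF a], rule sets_bs_measure[of ?\<alpha>, OF a])
  show "finite_measure \<mu>" "sets \<mu> = sets circle_borel" by (rule finite_measure_circle[OF mu])+
  show "\<forall>k\<ge>Suc n. coeff p k = 0" using p by (auto intro: coeff_eq_0)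
  fix m assume "m < Suc n"
  then have "circle_moment (bs_measure ?\<alpha> n) 0 (szego_poly ?\<alpha> m) = (if m = 0 then 1 else 0)"
    by (intro circle_moment_0_szego_poly[of ?\<alpha>, OF a]) simp
  moreover have "circle_moment \<mu> 0 (szego_poly ?\<alpha> m) = (if m = 0 then 1 else 0)"
    using is_monic_OP_szego_poly[OF mu, of m] nontrivial_circle_probD(1)[OF mu]
    by (auto simp: is_monic_OP_iff[OF mu] orthogonal_below_def circle_moment_def prob_space.prob_space)
  ultimately show "circle_moment (bs_measure ?\<alpha> n) 0 (szego_poly ?\<alpha> m) = circle_moment \<mu> 0 (szego_poly ?\<alpha> m)"
    by simp
qed

text \<open>In the product of the two tails z and its conjugate cancel, which leaves an instance of
  the induction hypothesis; the cross terms are analytic or conjugates of analytic ones, which real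
  parts do not distinguish.\<close>

lemma Re_poly_mult_cnj_on_circle:
  "\<exists>r :: complex poly. \<forall>z. norm z = 1 \<longrightarrow> Re (poly p z * cnj (poly q z)) = Re (poly r z)"
proof (induction p q rule: poly_induct2)
  case 0
  show ?case by (rule exI[of _ 0]) simp
next
  case (pCons a p b q)
  then obtain r where r: "\<And>z. norm z = 1 \<Longrightarrow> Re (poly p z * cnj (poly q z)) = Re (poly r z)" by blast
  let ?s = "[:a * cnj b:] + smult (cnj a) (pCons 0 q) + smult (cnj b) (pCons 0 p) + r"
  show ?case
  proof (intro exI[of _ ?s] allI impI)
    fix z :: complex assume z: "norm z = 1"
    then have zz: "z * cnj z = 1" by (metis complex_norm_square of_real_1 one_power2)
    have "poly (pCons a p) z * cnj (poly (pCons b q) z)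
        = a * cnj b + a * cnj (z * poly q z) + cnj b * (z * poly p z) + (z * cnj z) * (poly p z * cnj (poly q z))"
      by (simp add: algebra_simps)
    moreover have "Re (a * cnj (z * poly q z)) = Re (cnj a * (z * poly q z))" by (simp add: algebra_simps)
    ultimately have "Re (poly (pCons a p) z * cnj (poly (pCons b q) z))
        = Re (a * cnj b) + Re (cnj a * (z * poly q z)) + Re (cnj b * (z * poly p z)) + Re (poly r z)"
      by (simp only: zz plus_complex.simps mult_1 r[OF z])
    also have "\<dots> = Re (a * cnj b + cnj a * (z * poly q z) + cnj b * (z * poly p z) + poly r z)"
      by (simp only: plus_complex.simps)
    also have "\<dots> = Re (poly ?s z)" by (rule arg_cong[where f = Re]) (simp add: algebra_simps)
    finally show "Re (poly (pCons a p) z * cnj (poly (pCons b q) z)) = Re (poly ?s z)" .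
  qed
qed

lemma real_polynomial_function_on_circle:
  fixes g :: "complex \<Rightarrow> real"
  assumes "real_polynomial_function g"
  shows "\<exists>p. \<forall>z. norm z = 1 \<longrightarrow> g z = Re (poly p z)"
  using assms
proof induction
  case (linear f)
  \<comment> \<open>A real linear form is x f(1) + y f(i), the real part of (f(1) - i f(i))
    z.\<close>
  have "f z = Re (poly [:0, of_real (f 1) - \<i> * of_real (f \<i>):] z)" for z
  proof -
    interpret bounded_linear f by fact
    have "z = Re z *\<^sub>R 1 + Im z *\<^sub>R \<i>"
      by (simp add: complex_eq_iff)
    then have "f z = f (Re z *\<^sub>R 1 + Im z *\<^sub>R \<i>)"
      by (rule arg_cong)
    also have "\<dots> = Re z * f 1 + Im z * f \<i>" by (simp only: add scaleR real_scaleR_def)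
    finally show ?thesis by simp
  qed
  then show ?case by blast
next
  case (const c)
  show ?case by (rule exI[of _ "[:of_real c:]"]) simp
next
  case (add f g)
  then obtain p q where "\<forall>z. norm z = 1 \<longrightarrow> f z = Re (poly p z)" "\<forall>z. norm z = 1 \<longrightarrow> g z = Re (poly q z)" by blast
  then show ?case by (intro exI[of _ "p + q"]) simp
next
  case (mult f g)
  then obtain p q where pq: "\<forall>z. norm z = 1 \<longrightarrow> f z = Re (poly p z)" "\<forall>z. norm z = 1 \<longrightarrow> g z = Re (poly q z)" by blast
  obtain r where r: "\<forall>z. norm z = 1 \<longrightarrow> Re (poly p z * cnj (poly q z)) = Re (poly r z)"
    using Re_poly_mult_cnj_on_circle by blast
  \<comment> \<open>Splits the product into an analytic part and one covered by
    \<open>Re_poly_mult_cnj_on_circle\<close>.\<close>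
  have "Re u * Re v = (Re (u * v) + Re (u * cnj v)) / 2" for u v by simp
  then have "\<forall>z. norm z = 1 \<longrightarrow> f z * g z = Re (poly (smult (1/2) (p * q + r)) z)"
    using pq r by (auto simp del: times_complex.simps)
  then show ?case by blast
qed

text \<open>By Stone-Weierstrass it suffices to test real parts of polynomials, and for these the
  two integrals agree exactly once n reaches the degree.\<close>

lemma bs_measure_weak_convergence:
  fixes f :: "complex \<Rightarrow> real"
  assumes mu: "nontrivial_circle_prob \<mu>" and f: "continuous_on (sphere 0 1) f"
  shows "(\<lambda>n. integral\<^sup>L (bs_measure (verblunsky \<mu>) n) f) \<longlonglongrightarrow> integral\<^sup>L \<mu> f"
proof (rule LIMSEQ_I)
  let ?\<nu> = "bs_measure (verblunsky \<mu>)"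
  note a = verblunsky_norm(1)[OF mu]
  note fs = finite_measure_bs_measure[of "verblunsky \<mu>", OF a] sets_bs_measure[of "verblunsky \<mu>", OF a]
  fix e :: real assume "0 < e"
  then obtain g where g: "real_polynomial_function g" "\<And>z. z \<in> sphere 0 1 \<Longrightarrow> \<bar>f z - g z\<bar> < e / 4"
    using Stone_Weierstrass_real_polynomial_function[OF compact_sphere f, of "e / 4"] by auto
  obtain p where p: "\<And>z. norm z = 1 \<Longrightarrow> g z = Re (poly p z)"
    using real_polynomial_function_on_circle[OF g(1)] by blast
  have close: "\<bar>integral\<^sup>L \<nu> f - Re (circle_moment \<nu> 0 p)\<bar> \<le> e / 4"
    if \<nu>: "finite_measure \<nu>" "sets \<nu> = sets circle_borel" "circle_moment \<nu> 0 1 = 1" for \<nu>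
  proof -
    have sp: "space \<nu> = sphere 0 1" using sets_eq_imp_space_eq[OF \<nu>(2)] by simp
    interpret finite_measure \<nu> by fact
    have "complex_of_real (measure \<nu> (space \<nu>)) = 1" using \<nu>(3) by (simp add: circle_moment_def scaleR_conv_of_real)
    then have m1: "measure \<nu> (space \<nu>) = 1" by (simp only: of_real_eq_1_iff)
    have pi: "integrable \<nu> (poly p)" by (intro integrable_circle[OF \<nu>(1,2)] continuous_intros)
    have fi: "integrable \<nu> f" by (rule integrable_circle[OF \<nu>(1,2) f])
    have ri: "integrable \<nu> (\<lambda>z. Re (poly p z))" using pi by (rule integrable_Re)
    have "Re (circle_moment \<nu> 0 p) = (\<integral>z. Re (poly p z) \<partial>\<nu>)"
      using pi by (simp add: circle_moment_def)
    then have "\<bar>integral\<^sup>L \<nu> f - Re (circle_moment \<nu> 0 p)\<bar> = \<bar>\<integral>z. f z - Re (poly p z) \<partial>\<nu>\<bar>"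
      using fi ri by simp
    also have "\<dots> \<le> (\<integral>z. \<bar>f z - Re (poly p z)\<bar> \<partial>\<nu>)" by (rule integral_abs_bound)
    also have "\<dots> \<le> (\<integral>z. e / 4 \<partial>\<nu>)"
    proof (intro integral_mono)
      fix z assume "z \<in> space \<nu>"
      then show "\<bar>f z - Re (poly p z)\<bar> \<le> e / 4" using g(2)[of z] p[of z] sp by simp
    qed (use fi ri in auto)
    finally show ?thesis using m1 by simp
  qed
  show "\<exists>no. \<forall>n\<ge>no. norm (integral\<^sup>L (?\<nu> n) f - integral\<^sup>L \<mu> f) < e"
  proof (intro exI allI impI)
    fix n assume n: "degree p \<le> n"
    have one: "circle_moment \<mu> 0 1 = 1"
      using nontrivial_circle_probD(1)[OF mu] by (simp add: circle_moment_def prob_space.prob_space)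
    have "\<bar>integral\<^sup>L (?\<nu> n) f - Re (circle_moment (?\<nu> n) 0 p)\<bar> \<le> e / 4"
      using circle_moment_bs_measure_eq[OF mu, of 1 n] one by (intro close fs) simp
    moreover have "\<bar>integral\<^sup>L \<mu> f - Re (circle_moment \<mu> 0 p)\<bar> \<le> e / 4"
      by (intro close finite_measure_circle[OF mu] one)
    ultimately show "norm (integral\<^sup>L (?\<nu> n) f - integral\<^sup>L \<mu> f) < e"
      using circle_moment_bs_measure_eq[OF mu n] \<open>0 < e\<close> 
      unfolding real_norm_def abs_less_iff abs_le_iff by auto
  qed
qed

section \<open>Approximation of Borel functions by continuous functions\<close>

text \<open>Outer regularity for B and for its complement; the closed set is the complement of the
  second open one.\<close>

lemma borel_sandwich:
  fixes M :: "'a::euclidean_space measure"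
  assumes "finite_measure M" and sets: "sets M = sets borel" and B: "B \<in> sets borel" and e: "0 < e"
  shows "\<exists>K U. closed K \<and> open U \<and> K \<subseteq> B \<and> B \<subseteq> U \<and> measure M (U - K) < e"
proof -
  interpret finite_measure M by fact
  have sp: "space M = UNIV" using sets_eq_imp_space_eq[OF sets] by simp
  have outer: "\<exists>U. open U \<and> A \<subseteq> U \<and> measure M U < measure M A + e / 2" if A: "A \<in> sets borel" for A
  proof -
    have "emeasure M A < ennreal (measure M A + e / 2)"
      unfolding emeasure_eq_measure using e by (intro ennreal_lessI) (auto simp: add_nonneg_pos)
    then have "(INF U \<in> {U. A \<subseteq> U \<and> open U}. emeasure M U) < ennreal (measure M A + e / 2)"
      using outer_regular[OF sets _ A] by simp
    then obtain U where U: "A \<subseteq> U" "open U" "emeasure M U < ennreal (measure M A + e / 2)"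
      unfolding INF_less_iff by blast
    then have "measure M U < measure M A + e / 2"
      unfolding emeasure_eq_measure by (subst (asm) ennreal_less_iff) auto
    with U show ?thesis by blast
  qed
  obtain U where U: "open U" "B \<subseteq> U" "measure M U < measure M B + e / 2" using outer[OF B] by blast
  obtain V where V: "open V" "- B \<subseteq> V" "measure M V < measure M (- B) + e / 2" using outer[of "- B"] B by auto
  have "measure M (U - (- V)) \<le> measure M (U - B) + measure M (V - (- B))"
  proof -
    have "U - (- V) \<subseteq> (U - B) \<union> (V - (- B))" by blast
    then have "measure M (U - (- V)) \<le> measure M ((U - B) \<union> (V - (- B)))"
      using U V B by (intro finite_measure_mono) (auto simp: sets)
    also have "\<dots> \<le> measure M (U - B) + measure M (V - (- B))"
      using U V B by (intro measure_Un_le) (auto simp: sets)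
    finally show ?thesis .
  qed
  also have "\<dots> = measure M U - measure M B + (measure M V - measure M (- B))"
    using U V B finite_measure_Diff[of U B] finite_measure_Diff[of V "- B"] by (simp add: sets)
  also have "\<dots> < e" using U V by simp
  finally show ?thesis using U V by (intro exI[of _ "- V"] exI[of _ U]) auto
qed

text \<open>One function serves both measures: the inner closed sets are united, the outer open sets
  intersected, and Urysohn's lemma interpolates.\<close>

lemma indicator_continuous_approx:
  fixes M N :: "'a::euclidean_space measure"
  assumes M: "finite_measure M" "sets M = sets borel" and N: "finite_measure N" "sets N = sets borel"
    and B: "B \<in> sets borel" and e: "0 < e"
  shows "\<exists>u :: 'a \<Rightarrow> real. continuous_on UNIV u \<and> (\<forall>x. 0 \<le> u x \<and> u x \<le> 1) \<and>
    (\<integral>x. \<bar>indicator B x - u x\<bar> \<partial>M) < e \<and> (\<integral>x. \<bar>indicator B x - u x\<bar> \<partial>N) < e"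
proof -
  obtain K1 U1 where 1: "closed K1" "open U1" "K1 \<subseteq> B" "B \<subseteq> U1" "measure M (U1 - K1) < e"
    using borel_sandwich[OF M B e] by blast
  obtain K2 U2 where 2: "closed K2" "open U2" "K2 \<subseteq> B" "B \<subseteq> U2" "measure N (U2 - K2) < e"
    using borel_sandwich[OF N B e] by blast
  define K U where "K = K1 \<union> K2" and "U = U1 \<inter> U2"
  have KU: "closed K" "open U" "K \<subseteq> B" "B \<subseteq> U" using 1 2 by (auto simp: K_def U_def)
  obtain u :: "'a \<Rightarrow> real" where u: "continuous_on UNIV u" "\<And>x. u x \<in> closed_segment 1 0"
    "\<And>x. x \<in> K \<Longrightarrow> u x = 1" "\<And>x. x \<in> - U \<Longrightarrow> u x = 0"
    by (rule Urysohn[of K "- U" "1::real" 0]) (use KU in auto)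
  have u01: "0 \<le> u x \<and> u x \<le> 1" for x using u(2)[of x] by (simp add: closed_segment_eq_real_ivl split: if_splits)
  have bound: "\<bar>indicator B x - u x\<bar> \<le> indicator (U - K) x" for x
    using u01[of x] u(3,4)[of x] KU by (auto split: split_indicator)
  have int: "(\<integral>x. \<bar>indicator B x - u x\<bar> \<partial>L) \<le> measure L (U - K)" if L: "finite_measure L" "sets L = sets borel" for L
  proof -
    interpret finite_measure L by fact
    have [measurable]: "u \<in> borel_measurable L" "B \<in> sets L" "U - K \<in> sets L"
      using borel_measurable_continuous_onI[OF u(1)] B KU by (auto simp: L(2) measurable_cong_sets[OF L(2) refl])
    have "\<bar>indicator B x - u x\<bar> \<le> 1" for x using u01[of x] by (auto split: split_indicator)
    then have "integrable L (\<lambda>x. \<bar>indicator B x - u x\<bar>)"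
      by (intro integrable_const_bound[where B = 1]) auto
    then have "(\<integral>x. \<bar>indicator B x - u x\<bar> \<partial>L) \<le> (\<integral>x. indicator (U - K) x \<partial>L)"
      by (intro integral_mono bound) (auto simp: emeasure_eq_measure)
    then show ?thesis by simp
  qed
  have "measure M (U - K) \<le> measure M (U1 - K1)"
    using 1 2 by (intro finite_measure.finite_measure_mono[OF M(1)]) (auto simp: U_def K_def M(2))
  moreover have "measure N (U - K) \<le> measure N (U2 - K2)"
    using 1 2 by (intro finite_measure.finite_measure_mono[OF N(1)]) (auto simp: U_def K_def N(2))
  ultimately show ?thesis using u(1) u01 int[OF M] int[OF N] 1(5) 2(5)
    by (intro exI[of _ u]) auto
qed

text \<open>The sum counts the integers from 1 up to y, so it is the floor of y.\<close>

lemma staircase_approx: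
  assumes "0 \<le> (y::real)" "y \<le> n"
  shows "\<bar>y - (\<Sum>k=1..n. of_bool (real k \<le> y))\<bar> \<le> 1"
proof -
  have "{1..n} \<inter> {k. real k \<le> y} = {1..nat \<lfloor>y\<rfloor>}"
    using assms by (auto simp: le_nat_iff le_floor_iff)
  then have "(\<Sum>k=1..n. of_bool (real k \<le> y)) = real (nat \<lfloor>y\<rfloor>)"
    by simp
  then show ?thesis using assms(1) by linarith
qed

text \<open>Layer-cake argument: f is within 1/n of the average of the indicators of its n level
  sets, each replaced by a continuous function.\<close>

lemma bounded_continuous_approx:
  fixes M N :: "'a::euclidean_space measure" and f :: "'a \<Rightarrow> real"
  assumes M: "finite_measure M" "sets M = sets borel" and N: "finite_measure N" "sets N = sets borel"
    and f: "f \<in> borel_measurable borel" "\<And>x. 0 \<le> f x" "\<And>x. f x \<le> 1" and e: "0 < e"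
  shows "\<exists>u. continuous_on UNIV u \<and> (\<forall>x. 0 \<le> u x \<and> u x \<le> 1) \<and>
    (\<integral>x. \<bar>f x - u x\<bar> \<partial>M) < e \<and> (\<integral>x. \<bar>f x - u x\<bar> \<partial>N) < e"
proof -
  let ?m = "max (measure M UNIV) (measure N UNIV)"
  \<comment> \<open>The total error is at most ?m / n from the staircase plus e / 2 from the
    indicators.\<close>
  obtain n :: nat where n: "2 * (?m + 1) / e < n" using reals_Archimedean2 by blast
  have m0: "0 \<le> ?m" by (simp add: max_def)
  have n0: "0 < n" using n e m0 by (metis divide_nonneg_pos add_nonneg_nonneg gr0I less_le_not_le mult_nonneg_nonneg of_nat_0 zero_le_one zero_le_numeral)
  define B where "B k = {x. real k \<le> n * f x}" for k
  have "B k \<in> sets borel" for k unfolding B_def using f(1) by measurable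
  then have "\<forall>k. \<exists>u :: 'a \<Rightarrow> real. continuous_on UNIV u \<and> (\<forall>x. 0 \<le> u x \<and> u x \<le> 1) \<and>
    (\<integral>x. \<bar>indicator (B k) x - u x\<bar> \<partial>M) < e / 2 \<and> (\<integral>x. \<bar>indicator (B k) x - u x\<bar> \<partial>N) < e / 2"
    using e by (intro allI indicator_continuous_approx[OF M N]) auto
  then obtain v :: "nat \<Rightarrow> 'a \<Rightarrow> real" where v: "\<And>k. continuous_on UNIV (v k)" "\<And>k x. 0 \<le> v k x" "\<And>k x. v k x \<le> 1"
    "\<And>k. (\<integral>x. \<bar>indicator (B k) x - v k x\<bar> \<partial>M) < e / 2" "\<And>k. (\<integral>x. \<bar>indicator (B k) x - v k x\<bar> \<partial>N) < e / 2"
    by (metis (no_types))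
  define u where "u x = (\<Sum>k=1..n. v k x) / n" for x
  have uc: "continuous_on UNIV u" unfolding u_def using n0 by (intro continuous_intros v) auto
  have u01: "0 \<le> u x \<and> u x \<le> 1" for x
    using sum_bounded_above[of "{1..n}" "\<lambda>k. v k x" 1] v(2,3) n0
    by (auto simp: u_def sum_nonneg)
  have pt: "\<bar>f x - u x\<bar> \<le> (1 + (\<Sum>k=1..n. \<bar>indicator (B k) x - v k x\<bar>)) / n" for x
  proof -
    have "\<bar>n * f x - (\<Sum>k=1..n. of_bool (real k \<le> n * f x))\<bar> \<le> 1"
      using f(2,3)[of x] mult_left_mono[OF f(3)[of x], of "real n"] by (intro staircase_approx) auto
    moreover have "(\<Sum>k=1..n. of_bool (real k \<le> n * f x)) = (\<Sum>k=1..n. indicator (B k) x :: real)"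
      by (intro sum.cong refl) (auto simp: B_def split: split_indicator)
    moreover have "\<bar>(\<Sum>k=1..n. indicator (B k) x) - (\<Sum>k=1..n. v k x)\<bar> \<le> (\<Sum>k=1..n. \<bar>indicator (B k) x - v k x\<bar>)"
      unfolding sum_subtractf[symmetric] by (rule sum_abs)
    ultimately have "\<bar>n * f x - (\<Sum>k=1..n. v k x)\<bar> \<le> 1 + (\<Sum>k=1..n. \<bar>indicator (B k) x - v k x\<bar>)" by linarith
    moreover have "\<bar>f x - u x\<bar> = \<bar>n * f x - (\<Sum>k=1..n. v k x)\<bar> / n"
    proof -
      have "f x - u x = (n * f x - (\<Sum>k=1..n. v k x)) / n" using n0 by (simp add: u_def field_simps)
      then show ?thesis by (simp add: abs_divide)
    qed
    ultimately show ?thesis by (simp add: divide_right_mono)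
  qed
  have int: "(\<integral>x. \<bar>f x - u x\<bar> \<partial>L) < e" if L: "finite_measure L" "sets L = sets borel"
    and m: "measure L UNIV \<le> ?m" and l: "\<And>k. (\<integral>x. \<bar>indicator (B k) x - v k x\<bar> \<partial>L) < e / 2" for L
  proof -
    interpret finite_measure L by fact
    have sp: "space L = UNIV" using sets_eq_imp_space_eq[OF L(2)] by simp
    have ms: "borel_measurable L = borel_measurable borel" by (rule measurable_cong_sets[OF L(2) refl])
    have [measurable]: "u \<in> borel_measurable L" "f \<in> borel_measurable L" "\<And>k. v k \<in> borel_measurable L" "\<And>k. B k \<in> sets L"
      using borel_measurable_continuous_onI[OF uc] borel_measurable_continuous_onI[OF v(1)] f(1) \<open>\<And>k. B k \<in> sets borel\<close>
      by (auto simp: ms L(2))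
    have i1: "integrable L (\<lambda>x. \<bar>f x - u x\<bar>)"
    proof (intro integrable_const_bound[where B = 1] AE_I2)
      show "norm \<bar>f x - u x\<bar> \<le> 1" for x using u01[of x] f(2,3)[of x]
        unfolding real_norm_def abs_idempotent abs_le_iff by auto
    qed simp
    have i2: "integrable L (\<lambda>x. \<bar>indicator (B k) x - v k x\<bar>)" for k
      using v(2,3)[of k] by (intro integrable_const_bound[where B = 1]) (auto intro!: AE_I2 split: split_indicator)
    have "(\<integral>x. \<bar>f x - u x\<bar> \<partial>L) \<le> (\<integral>x. (1 + (\<Sum>k=1..n. \<bar>indicator (B k) x - v k x\<bar>)) / n \<partial>L)"
      by (intro integral_mono pt i1 integrable_divide Bochner_Integration.integrable_add Bochner_Integration.integrable_sum i2) auto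
    also have "\<dots> = (measure L UNIV + (\<Sum>k=1..n. (\<integral>x. \<bar>indicator (B k) x - v k x\<bar> \<partial>L))) / n"
      using i2 by (simp add: Bochner_Integration.integral_add Bochner_Integration.integral_sum sp)
    also have "\<dots> \<le> (?m + n * (e / 2)) / n"
      using m sum_bounded_above[of "{1..n}" "\<lambda>k. \<integral>x. \<bar>indicator (B k) x - v k x\<bar> \<partial>L" "e / 2"] l
      by (intro divide_right_mono add_mono) (auto intro: less_imp_le)
    also have "\<dots> < e"
    proof -
      have "2 * (?m + 1) < n * e" using n e by (simp add: field_simps)
      then show ?thesis using n0 by (simp add: field_simps)
    qed
    finally show ?thesis .
  qed
  show ?thesis using uc u01 int[OF M] int[OF N] v by (intro exI[of _ u]) auto
qed

section \<open>The relative entropy argument\<close>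

lemma nn_integral_sum_measures:
  assumes s: "sets M1 = sets M" "sets M2 = sets M"
    and eq: "\<And>A. A \<in> sets M \<Longrightarrow> emeasure M A = emeasure M1 A + emeasure M2 A"
    and f: "f \<in> borel_measurable M"
  shows "(\<integral>\<^sup>+x. f x \<partial>M) = (\<integral>\<^sup>+x. f x \<partial>M1) + (\<integral>\<^sup>+x. f x \<partial>M2)"
  using f
proof (induct rule: borel_measurable_induct)
  case (cong f g)
  note sp = sets_eq_imp_space_eq[OF s(1)] sets_eq_imp_space_eq[OF s(2)]
  have "integral\<^sup>N L f = integral\<^sup>N L g" if "space L = space M" for L
    by (intro nn_integral_cong) (use cong that in auto)
  then show ?case using cong(4) sp by simp
next
  case (set A)
  then show ?case by (simp add: eq s)
next
  case (mult u c)
  then have "u \<in> borel_measurable M1" "u \<in> borel_measurable M2"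
    by (simp_all add: measurable_cong_sets[OF s(1) refl] measurable_cong_sets[OF s(2) refl])
  with mult show ?case by (simp add: nn_integral_cmult ring_distribs)
next
  case (add u v)
  then have "u \<in> borel_measurable M1" "u \<in> borel_measurable M2" "v \<in> borel_measurable M1" "v \<in> borel_measurable M2"
    by (simp_all add: measurable_cong_sets[OF s(1) refl] measurable_cong_sets[OF s(2) refl])
  with add show ?case by (simp add: nn_integral_add ac_simps)
next
  case (seq U)
  then have m: "\<And>i. U i \<in> borel_measurable M1" "\<And>i. U i \<in> borel_measurable M2"
    by (simp_all add: measurable_cong_sets[OF s(1) refl] measurable_cong_sets[OF s(2) refl])
  have S: "integral\<^sup>N L (\<Squnion>i. U i) = (SUP i. integral\<^sup>N L (U i))" if "\<And>i. U i \<in> borel_measurable L" for L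
    unfolding SUP_apply[abs_def] using seq that by (intro nn_integral_monotone_convergence_SUP) auto
  have "incseq (\<lambda>i. integral\<^sup>N L (U i))" for L
    using seq by (intro incseq_SucI nn_integral_mono) (auto simp: incseq_Suc_iff le_fun_def)
  then show ?case
    unfolding S[OF seq(1)] S[OF m(1)] S[OF m(2)] by (simp add: seq(3) ennreal_SUP_add)
qed

section \<open>Logarithmic integrals against the weight 1 - cos 3\<theta>\<close>

lemma integrable_cis:
  fixes f :: "complex \<Rightarrow> 'b::{banach, second_countable_topology}"
  assumes "continuous_on (sphere 0 1) f"
  shows "integrable angle_measure (\<lambda>\<theta>. f (cis \<theta>))"
  using integrable_circle[OF prob_space.finite_measure[OF prob_space_arc_length] sets_arc_length assms]
  unfolding arc_length_def by (rule integrable_distr[rotated]) measurable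

lemma one_minus_cos_3_cis: "1 - cos (3 * \<theta>) = 1 - Re (cis \<theta> ^ 3)"
  using Complex.DeMoivre[of \<theta> 3] by simp

lemma integral_one_minus_cos_3: "(\<integral>\<theta>. 1 - cos (3 * \<theta>) \<partial>angle_measure) = 1"
proof -
  interpret prob_space angle_measure by (rule prob_space_angle_measure)
  have i: "integrable angle_measure (\<lambda>\<theta>. cis \<theta> ^ 3)"
    by (rule integrable_cis[of "\<lambda>z. z ^ 3"]) (intro continuous_intros)
  have "(\<integral>\<theta>. cis \<theta> ^ 3 \<partial>angle_measure) = 0"
    using circle_taylor_coeff[of "\<lambda>z. z ^ 3" 0] by (simp add: continuous_intros holomorphic_intros)
  then have "(\<integral>\<theta>. Re (cis \<theta> ^ 3) \<partial>angle_measure) = 0" using integral_Re[OF i] by simp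
  moreover have "integrable angle_measure (\<lambda>\<theta>. Re (cis \<theta> ^ 3))" by (rule integrable_Re[OF i])
  ultimately show ?thesis
    unfolding one_minus_cos_3_cis using prob_space by (subst Bochner_Integration.integral_diff) auto
qed

lemma one_minus_cos_bounds: "0 \<le> 1 - cos x" "1 - cos x \<le> (2::real)"
  using cos_le_one[of x] cos_ge_minus_one[of x] by linarith+

lemma weighted_ln_le:
  assumes "0 < y"
  shows "(1 - cos x) * ln y \<le> 2 * (y::real)"
proof -
  have "(1 - cos x) * ln y \<le> (1 - cos x) * y"
    using ln_le_minus_one[OF assms] by (intro mult_left_mono one_minus_cos_bounds) auto
  also have "\<dots> \<le> 2 * y" using assms by (intro mult_right_mono one_minus_cos_bounds) auto
  finally show ?thesis .
qed

text \<open>The \<open>Z\<close> sequence of the overview.\<close>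

definition bs_log_integral :: "(nat \<Rightarrow> complex) \<Rightarrow> nat \<Rightarrow> real" where
  "bs_log_integral \<alpha> n = (\<integral>\<theta>. (1 - cos (3 * \<theta>)) * ln (bs_weight \<alpha> n (cis \<theta>)) \<partial>angle_measure)"

lemma integrable_weighted_ln:
  assumes "continuous_on (sphere 0 1) f" "\<And>z. norm z = 1 \<Longrightarrow> 0 < f z"
  shows "integrable angle_measure (\<lambda>\<theta>. (1 - cos (3 * \<theta>)) * ln (f (cis \<theta>)))"
  unfolding one_minus_cos_3_cis
proof (rule integrable_cis[of "\<lambda>z. (1 - Re (z ^ 3)) * ln (f z)"])
  show "continuous_on (sphere 0 1) (\<lambda>z. (1 - Re (z ^ 3)) * ln (f z))"
    using assms(2) by (intro continuous_intros assms(1)) (auto dest!: assms(2))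
qed

text \<open>The constant enters with the mean 1 of the weight; the power -2 of the polynomial
  cancels the factor -1/2 of \<open>integral_log_norm_poly\<close>.\<close>

lemma bs_log_integral_eq:
  assumes a: "\<And>n. norm (\<alpha> n) < 1"
  shows "bs_log_integral \<alpha> n = ln (szego_norm \<alpha> n) + Re (log_coeff3 (szego_rev \<alpha> n))"
proof -
  let ?q = "szego_rev \<alpha> n"
  note nz = szego_rev_nonzero[of \<alpha>, OF a]
  have eq: "(1 - cos (3 * \<theta>)) * ln (bs_weight \<alpha> n (cis \<theta>))
      = ln (szego_norm \<alpha> n) * (1 - cos (3 * \<theta>)) - 2 * ((1 - cos (3 * \<theta>)) * ln (norm (poly ?q (cis \<theta>))))" for \<theta>
    using szego_norm_pos[of \<alpha> n, OF a] nz[of "cis \<theta>" n]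
    by (simp add: bs_weight_def ln_div ln_realpow algebra_simps)
  have 1: "integrable angle_measure (\<lambda>\<theta>. 1 - cos (3 * \<theta>))"
    unfolding one_minus_cos_3_cis by (rule integrable_cis[of "\<lambda>z. 1 - Re (z ^ 3)"]) (intro continuous_intros)
  have 2: "integrable angle_measure (\<lambda>\<theta>. (1 - cos (3 * \<theta>)) * ln (norm (poly ?q (cis \<theta>))))"
    using nz by (intro integrable_weighted_ln[of "\<lambda>z. norm (poly ?q z)"] continuous_intros) auto
  have "bs_log_integral \<alpha> n = ln (szego_norm \<alpha> n) * (\<integral>\<theta>. 1 - cos (3 * \<theta>) \<partial>angle_measure)
      - 2 * (\<integral>\<theta>. (1 - cos (3 * \<theta>)) * ln (norm (poly ?q (cis \<theta>))) \<partial>angle_measure)"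
    unfolding bs_log_integral_def eq using 1 2
    by (subst Bochner_Integration.integral_diff) (auto simp del: Bochner_Integration.integral_diff)
  also have "\<dots> = ln (szego_norm \<alpha> n) + Re (log_coeff3 ?q)"
    using integral_log_norm_poly[of ?q, OF coeff_szego_rev_0 nz] unfolding integral_one_minus_cos_3 by simp
  finally show ?thesis .
qed

text \<open>The left side does not depend on n, so only the integral of f against the approximating
  measures has to pass to the limit.\<close>

lemma weighted_ln_integral_le_continuous:
  fixes f :: "complex \<Rightarrow> real"
  assumes mu: "nontrivial_circle_prob \<mu>" and C: "\<And>n. - C \<le> bs_log_integral (verblunsky \<mu>) n"
    and f: "continuous_on (sphere 0 1) f" "\<And>z. norm z = 1 \<Longrightarrow> 0 < f z"
  shows "(\<integral>\<theta>. (1 - cos (3 * \<theta>)) * ln (f (cis \<theta>)) \<partial>angle_measure) \<le> C + 2 * (\<integral>z. f z \<partial>\<mu>)"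
proof -
  let ?\<alpha> = "verblunsky \<mu>"
  let ?I = "\<integral>\<theta>. (1 - cos (3 * \<theta>)) * ln (f (cis \<theta>)) \<partial>angle_measure"
  note a = verblunsky_norm(1)[OF mu]
  note wp = bs_weight_pos[of ?\<alpha>, OF a] and wc = continuous_on_bs_weight[of ?\<alpha>, OF a]
  have "?I \<le> C + 2 * integral\<^sup>L (bs_measure ?\<alpha> n) f" for n
  proof -
    let ?w = "bs_weight ?\<alpha> n"
    have i1: "integrable angle_measure (\<lambda>\<theta>. (1 - cos (3 * \<theta>)) * ln (f (cis \<theta>)))"
      by (rule integrable_weighted_ln[OF f])
    have i2: "integrable angle_measure (\<lambda>\<theta>. (1 - cos (3 * \<theta>)) * ln (?w (cis \<theta>)))"
      by (rule integrable_weighted_ln[OF wc wp])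
    have c: "continuous_on (sphere 0 1) (\<lambda>z. ?w z *\<^sub>R f z)" by (intro continuous_intros f wc)
    have i3: "integrable angle_measure (\<lambda>\<theta>. 2 * (?w (cis \<theta>) *\<^sub>R f (cis \<theta>)))"
      by (intro integrable_mult_right integrable_cis[OF c])
    have "?I + bs_log_integral ?\<alpha> n = (\<integral>\<theta>. (1 - cos (3 * \<theta>)) * ln (f (cis \<theta>)) + (1 - cos (3 * \<theta>)) * ln (?w (cis \<theta>)) \<partial>angle_measure)"
      unfolding bs_log_integral_def using i1 i2 by simp
    also have "\<dots> \<le> (\<integral>\<theta>. 2 * (?w (cis \<theta>) *\<^sub>R f (cis \<theta>)) \<partial>angle_measure)"
    proof (intro integral_mono Bochner_Integration.integrable_add i1 i2 i3)
      fix \<theta>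
      have "(1 - cos (3 * \<theta>)) * ln (?w (cis \<theta>) * f (cis \<theta>)) \<le> 2 * (?w (cis \<theta>) * f (cis \<theta>))"
        by (intro weighted_ln_le mult_pos_pos wp f) auto
      moreover have "ln (?w (cis \<theta>) * f (cis \<theta>)) = ln (?w (cis \<theta>)) + ln (f (cis \<theta>))"
        by (intro ln_mult_pos wp f) auto
      ultimately show "(1 - cos (3 * \<theta>)) * ln (f (cis \<theta>)) + (1 - cos (3 * \<theta>)) * ln (?w (cis \<theta>)) \<le> 2 * (?w (cis \<theta>) *\<^sub>R f (cis \<theta>))"
        by (simp add: algebra_simps)
    qed
    also have "\<dots> = 2 * integral\<^sup>L (bs_measure ?\<alpha> n) f"
      using integral_bs_measure[of ?\<alpha>, OF a f(1)] integral_arc_length[OF c] by simp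
    finally show ?thesis using C[of n] by simp
  qed
  moreover have "(\<lambda>n. C + 2 * integral\<^sup>L (bs_measure ?\<alpha> n) f) \<longlonglongrightarrow> C + 2 * (\<integral>z. f z \<partial>\<mu>)"
    by (intro tendsto_intros bs_measure_weak_convergence[OF mu f(1)])
  ultimately show ?thesis by (intro LIMSEQ_le_const[OF _]) auto
qed

lemma measurable_ident_circle: "sets \<nu> = sets circle_borel \<Longrightarrow> (\<lambda>z. z) \<in> measurable \<nu> borel"
  using borel_measurable_circle[of "\<lambda>z. z"] measurable_cong_sets[of \<nu> circle_borel borel borel] by simp

text \<open>On values at least 1 the logarithm is 1-Lipschitz, so approximation in the mean controls
  the logarithmic integral. The approximant must be good for arc length on the left and for \<mu> on
  the right; each side contributes e / 2.\<close>

lemma weighted_ln_integral_le_borel: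
  fixes f :: "complex \<Rightarrow> real"
  assumes mu: "nontrivial_circle_prob \<mu>" and C: "\<And>n. - C \<le> bs_log_integral (verblunsky \<mu>) n"
    and f[measurable]: "f \<in> borel_measurable borel" and f1: "\<And>z. 1 \<le> f z" and fK: "\<And>z. f z \<le> K"
  shows "(\<integral>\<theta>. (1 - cos (3 * \<theta>)) * ln (f (cis \<theta>)) \<partial>angle_measure) \<le> C + 2 * (\<integral>z. f z \<partial>\<mu>)"
proof (rule field_le_epsilon)
  fix e :: real assume e: "0 < e"
  have K: "1 \<le> K" using f1 fK order_trans by blast
  \<comment> \<open>Both measures are moved to the whole plane, where the approximation result
    applies.\<close>
  let ?M = "distr \<mu> borel (\<lambda>z. z)" and ?N = "distr arc_length borel (\<lambda>z. z)"
  note fm = finite_measure_circle[OF mu]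
  note ma = prob_space.finite_measure[OF prob_space_arc_length]
  note idm = measurable_ident_circle[OF fm(2)] and ida = measurable_ident_circle[OF sets_arc_length]
  interpret A: prob_space angle_measure by (rule prob_space_angle_measure)
  interpret M: prob_space \<mu> by (rule nontrivial_circle_probD(1)[OF mu])
  have "0 \<le> (f x - 1) / K \<and> (f x - 1) / K \<le> 1" for x using K f1[of x] fK[of x] by simp
  moreover have "finite_measure ?M" "finite_measure ?N"
    by (rule finite_measure.finite_measure_distr[OF fm(1) idm], rule finite_measure.finite_measure_distr[OF ma ida])
  moreover have "0 < e / (4 * K)" using e K by simp
  ultimately obtain u where u: "continuous_on UNIV u" "\<And>x. 0 \<le> u x" "\<And>x. u x \<le> 1"
    "(\<integral>x. \<bar>(f x - 1) / K - u x\<bar> \<partial>?M) < e / (4 * K)" "(\<integral>x. \<bar>(f x - 1) / K - u x\<bar> \<partial>?N) < e / (4 * K)"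
    using bounded_continuous_approx[of ?M ?N "\<lambda>x. (f x - 1) / K" "e / (4 * K)"] by auto
  have [measurable]: "u \<in> borel_measurable borel" by (rule borel_measurable_continuous_onI[OF u(1)])
  \<comment> \<open>Undoes the rescaling of f to [0, 1]; the summand 1 keeps g at least 1.\<close>
  define g where "g z = 1 + K * u z" for z
  have gc: "continuous_on S g" for S unfolding g_def by (intro continuous_intros continuous_on_subset[OF u(1)]) auto
  have g[measurable]: "g \<in> borel_measurable borel" by (rule borel_measurable_continuous_onI[OF gc])
  have g1: "1 \<le> g z" for z using u(2)[of z] K by (simp add: g_def)
  have gK: "g z \<le> 1 + K" for z using mult_left_mono[OF u(3)[of z], of K] K by (simp add: g_def)
  have fg: "\<bar>f z - g z\<bar> = K * \<bar>(f z - 1) / K - u z\<bar>" for z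
  proof -
    have "f z - g z = K * ((f z - 1) / K - u z)" using K by (simp add: g_def field_simps)
    then show ?thesis using K by (simp add: abs_mult)
  qed
  have fgK: "\<bar>f z - g z\<bar> \<le> 2 * K" for z
    using f1[of z] fK[of z] g1[of z] gK[of z] K unfolding abs_le_iff by auto
  have cis[measurable]: "cis \<in> borel_measurable borel" by (intro borel_measurable_continuous_onI continuous_intros)
  have ib\<mu>: "integrable \<mu> h" if h[measurable]: "h \<in> borel_measurable borel" and "\<And>z. \<bar>h z\<bar> \<le> B" for h :: "complex \<Rightarrow> real" and B
    using measurable_compose[OF idm h] that(2) by (intro M.integrable_const_bound[where B = B]) auto
  have "\<bar>f z\<bar> \<le> K" "\<bar>g z\<bar> \<le> 1 + K" for z using f1[of z] fK[of z] g1[of z] gK[of z] by auto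
  then have fb: "integrable \<mu> f" "integrable \<mu> g" "integrable \<mu> (\<lambda>z. \<bar>f z - g z\<bar>)"
    using fgK by (auto intro!: ib\<mu>[of f K] ib\<mu>[of g "1 + K"] ib\<mu>[of "\<lambda>z. \<bar>f z - g z\<bar>" "2 * K"])
  have 1: "(\<integral>z. \<bar>f z - g z\<bar> \<partial>\<mu>) < e / 4"
  proof -
    have "(\<integral>z. \<bar>f z - g z\<bar> \<partial>\<mu>) = K * (\<integral>x. \<bar>(f x - 1) / K - u x\<bar> \<partial>?M)"
      unfolding fg by (subst integral_distr[OF idm]) auto
    also have "\<dots> < K * (e / (4 * K))" using u(4) K by (intro mult_strict_left_mono) auto
    finally show ?thesis using K by simp
  qed
  have 2: "(\<integral>\<theta>. \<bar>f (cis \<theta>) - g (cis \<theta>)\<bar> \<partial>angle_measure) < e / 4"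
  proof -
    have "(\<integral>\<theta>. \<bar>f (cis \<theta>) - g (cis \<theta>)\<bar> \<partial>angle_measure) = (\<integral>z. \<bar>f z - g z\<bar> \<partial>arc_length)"
      unfolding arc_length_def by (subst integral_distr[OF cis_measurable]) (auto intro!: borel_measurable_circle)
    also have "\<dots> = K * (\<integral>x. \<bar>(f x - 1) / K - u x\<bar> \<partial>?N)"
      unfolding fg by (subst integral_distr[OF ida]) auto
    also have "\<dots> < K * (e / (4 * K))" using u(5) K by (intro mult_strict_left_mono) auto
    finally show ?thesis using K by simp
  qed
  have ib: "integrable angle_measure (\<lambda>\<theta>. (1 - cos (3 * \<theta>)) * ln (h (cis \<theta>)))"
    if [measurable]: "h \<in> borel_measurable borel" and h: "\<And>z. 1 \<le> h z" "\<And>z. h z \<le> B" for h :: "complex \<Rightarrow> real" and B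
  proof (intro A.integrable_const_bound[where B = "2 * ln B"] AE_I2)
    fix \<theta>
    have "0 \<le> ln (h (cis \<theta>))" "ln (h (cis \<theta>)) \<le> ln B" using h[of "cis \<theta>"] by auto
    then have "(1 - cos (3 * \<theta>)) * ln (h (cis \<theta>)) \<le> 2 * ln B" "0 \<le> (1 - cos (3 * \<theta>)) * ln (h (cis \<theta>))"
      by (intro mult_mono mult_nonneg_nonneg one_minus_cos_bounds; simp)+
    then show "norm ((1 - cos (3 * \<theta>)) * ln (h (cis \<theta>))) \<le> 2 * ln B" by simp
  qed measurable
  have if': "integrable angle_measure (\<lambda>\<theta>. (1 - cos (3 * \<theta>)) * ln (f (cis \<theta>)))" by (rule ib[OF f f1 fK])
  have ig: "integrable angle_measure (\<lambda>\<theta>. (1 - cos (3 * \<theta>)) * ln (g (cis \<theta>)))" by (rule ib[OF g g1 gK])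
  have ifg: "integrable angle_measure (\<lambda>\<theta>. 2 * \<bar>f (cis \<theta>) - g (cis \<theta>)\<bar>)"
    using fgK by (intro integrable_mult_right A.integrable_const_bound[where B = "2 * K"]) auto
  have "(\<integral>\<theta>. (1 - cos (3 * \<theta>)) * ln (f (cis \<theta>)) \<partial>angle_measure)
      \<le> (\<integral>\<theta>. (1 - cos (3 * \<theta>)) * ln (g (cis \<theta>)) + 2 * \<bar>f (cis \<theta>) - g (cis \<theta>)\<bar> \<partial>angle_measure)"
  proof (intro integral_mono if' Bochner_Integration.integrable_add ig ifg)
    fix \<theta>
    let ?z = "cis \<theta>"
    have "ln (f ?z) - ln (g ?z) = ln (f ?z / g ?z)" using f1[of ?z] g1[of ?z] by (simp add: ln_div)
    also have "\<dots> \<le> f ?z / g ?z - 1" using f1[of ?z] g1[of ?z] by (intro ln_le_minus_one) (auto intro: less_le_trans[OF zero_less_one])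
    also have "\<dots> = (f ?z - g ?z) / g ?z" using g1[of ?z] by (simp add: diff_divide_distrib)
    also have "\<dots> \<le> \<bar>f ?z - g ?z\<bar> / g ?z" using g1[of ?z] by (intro divide_right_mono) auto
    also have "\<dots> \<le> \<bar>f ?z - g ?z\<bar>" using g1[of ?z] by (simp add: divide_le_eq mult_le_cancel_left1)
    finally have "(1 - cos (3 * \<theta>)) * (ln (f ?z) - ln (g ?z)) \<le> 2 * \<bar>f ?z - g ?z\<bar>"
      by (meson abs_ge_zero mult_left_mono mult_right_mono one_minus_cos_bounds order_trans)
    then show "(1 - cos (3 * \<theta>)) * ln (f ?z) \<le> (1 - cos (3 * \<theta>)) * ln (g ?z) + 2 * \<bar>f ?z - g ?z\<bar>"
      by (simp add: algebra_simps)
  qed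
  also have "\<dots> = (\<integral>\<theta>. (1 - cos (3 * \<theta>)) * ln (g (cis \<theta>)) \<partial>angle_measure) + 2 * (\<integral>\<theta>. \<bar>f (cis \<theta>) - g (cis \<theta>)\<bar> \<partial>angle_measure)"
    using ig ifg by simp
  also have "\<dots> \<le> (C + 2 * (\<integral>z. g z \<partial>\<mu>)) + e / 2"
    using 2 by (intro add_mono weighted_ln_integral_le_continuous[OF mu C gc])
      (auto intro: less_le_trans[OF zero_less_one g1])
  finally have 3: "(\<integral>\<theta>. (1 - cos (3 * \<theta>)) * ln (f (cis \<theta>)) \<partial>angle_measure) \<le> C + 2 * (\<integral>z. g z \<partial>\<mu>) + e / 2" .
  have 4: "(\<integral>z. g z \<partial>\<mu>) \<le> (\<integral>z. f z \<partial>\<mu>) + (\<integral>z. \<bar>f z - g z\<bar> \<partial>\<mu>)"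
  proof -
    have "(\<integral>z. g z \<partial>\<mu>) \<le> (\<integral>z. f z + \<bar>f z - g z\<bar> \<partial>\<mu>)"
      by (intro integral_mono Bochner_Integration.integrable_add fb) auto
    also have "\<dots> = (\<integral>z. f z \<partial>\<mu>) + (\<integral>z. \<bar>f z - g z\<bar> \<partial>\<mu>)"
      by (rule Bochner_Integration.integral_add[OF fb(1,3)])
    finally show ?thesis .
  qed
  show "(\<integral>\<theta>. (1 - cos (3 * \<theta>)) * ln (f (cis \<theta>)) \<partial>angle_measure) \<le> C + 2 * (\<integral>z. f z \<partial>\<mu>) + e"
    using 1 3 4 by linarith
qed

section \<open>From the approximating weights back to w\<close>

lemma measurable_Arg2pi [measurable]: "Arg2pi \<in> borel_measurable borel"
  unfolding borel_measurable_iff_greater using open_Arg2pi2pi_gt by (auto intro: borel_open)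

text \<open>Transports w, a function of the angle, to the circle. The excluded endpoint 2 pi is
  null.\<close>

lemma Arg2pi_cis: "0 \<le> \<theta> \<Longrightarrow> \<theta> < 2 * pi \<Longrightarrow> Arg2pi (cis \<theta>) = \<theta>"
  by (rule Arg2pi_unique[of 1]) (auto simp: cis_conv_exp)

lemma AE_angle_measure: "AE \<theta> in angle_measure. 0 \<le> \<theta> \<and> \<theta> < 2 * pi"
proof -
  have "AE \<theta> in lborel. \<theta> \<noteq> 2 * pi" by (rule AE_lborel_singleton)
  then show ?thesis
    unfolding angle_measure_def by (intro AE_uniform_measureI) auto
qed

text \<open>The subtrahend in \<^const>\<open>szego_integral\<close>; the minuend is always finite.\<close>
definition szego_neg_integral :: "(real \<Rightarrow> real) \<Rightarrow> ennreal" where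
  "szego_neg_integral w = (\<integral>\<^sup>+\<theta>. e2ennreal (- (ereal (1 - cos (3 * \<theta>)) * elog (w \<theta>))) \<partial>angle_measure)"

context
  fixes \<mu> \<mu>s :: "complex measure" and w :: "real \<Rightarrow> real"
  assumes mu: "nontrivial_circle_prob \<mu>" and dec: "lebesgue_decomposition \<mu> w \<mu>s"
begin

lemma w_measurable: "w \<in> borel_measurable borel"
  using dec by (simp add: lebesgue_decomposition_def)

lemma AE_w_nonneg: "AE \<theta> in angle_measure. 0 \<le> w \<theta>"
  using AE_angle_measure by eventually_elim (use dec in \<open>auto simp: lebesgue_decomposition_def\<close>)

lemma nn_integral_decomposition:
  assumes f: "f \<in> borel_measurable circle_borel"
  shows "(\<integral>\<^sup>+z. f z \<partial>\<mu>) = (\<integral>\<^sup>+\<theta>. ennreal (w \<theta>) * f (cis \<theta>) \<partial>angle_measure) + (\<integral>\<^sup>+z. f z \<partial>\<mu>s)"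
proof -
  note [measurable] = w_measurable
  let ?\<nu> = "distr (density angle_measure (\<lambda>\<theta>. ennreal (w \<theta>))) circle_borel cis"
  note sm = nontrivial_circle_probD(2)[OF mu]
  have c: "cis \<in> measurable (density angle_measure (\<lambda>\<theta>. ennreal (w \<theta>))) circle_borel" by simp
  have "(\<integral>\<^sup>+z. f z \<partial>\<mu>) = (\<integral>\<^sup>+z. f z \<partial>?\<nu>) + (\<integral>\<^sup>+z. f z \<partial>\<mu>s)"
    using dec sm f by (intro nn_integral_sum_measures) (auto simp: lebesgue_decomposition_def measurable_cong_sets[OF sm refl])
  also have "(\<integral>\<^sup>+z. f z \<partial>?\<nu>) = (\<integral>\<^sup>+\<theta>. f (cis \<theta>) \<partial>density angle_measure (\<lambda>\<theta>. ennreal (w \<theta>)))"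
    using f by (intro nn_integral_distr c) simp
  also have "\<dots> = (\<integral>\<^sup>+\<theta>. ennreal (w \<theta>) * f (cis \<theta>) \<partial>angle_measure)"
    using measurable_compose[OF cis_measurable f] by (intro nn_integral_density) auto
  finally show ?thesis .
qed

lemma emeasure_parts_le_1:
  "(\<integral>\<^sup>+\<theta>. ennreal (w \<theta>) \<partial>angle_measure) \<le> 1" "emeasure \<mu>s (space \<mu>s) \<le> 1"
proof -
  note [measurable] = w_measurable
  have "(\<integral>\<^sup>+\<theta>. ennreal (w \<theta>) \<partial>angle_measure) + emeasure \<mu>s (space \<mu>s) = emeasure \<mu> (space \<mu>)"
    using nn_integral_decomposition[of "\<lambda>_. 1"] by simp
  also have "\<dots> = 1" using nontrivial_circle_probD(1)[OF mu] by (rule prob_space.emeasure_space_1)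
  finally show "(\<integral>\<^sup>+\<theta>. ennreal (w \<theta>) \<partial>angle_measure) \<le> 1" "emeasure \<mu>s (space \<mu>s) \<le> 1"
    by (metis le_iff_add, metis add.commute le_iff_add)
qed

text \<open>The positive part is at most 2 w and hence has a finite integral; only the negative part
  can produce -\<infinity>.\<close>

lemma szego_integral_gt_iff: "szego_integral w > - \<infinity> \<longleftrightarrow> szego_neg_integral w < \<infinity>"
proof -
  note [measurable] = w_measurable
  let ?p = "\<integral>\<^sup>+\<theta>. e2ennreal (ereal (1 - cos (3 * \<theta>)) * elog (w \<theta>)) \<partial>angle_measure"
  have "?p \<le> (\<integral>\<^sup>+\<theta>. 2 * ennreal (w \<theta>) \<partial>angle_measure)"
  proof (intro nn_integral_mono)
    fix \<theta>
    show "e2ennreal (ereal (1 - cos (3 * \<theta>)) * elog (w \<theta>)) \<le> 2 * ennreal (w \<theta>)"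
    proof (cases "w \<theta> \<le> 0")
      case True
      \<comment> \<open>The product is -\<infinity> for positive weight, and 0 where the weight
        vanishes, since 0 times -\<infinity> is 0 in \<open>ereal\<close>.\<close>
      moreover have "cos (3 * \<theta>) < 1 \<or> cos (3 * \<theta>) = 1" using cos_le_one[of "3 * \<theta>"] by linarith
      ultimately have "ereal (1 - cos (3 * \<theta>)) * elog (w \<theta>) \<le> 0" by (auto simp: elog_def)
      then show ?thesis by (simp add: e2ennreal_neg)
    next
      case False
      then have "ennreal ((1 - cos (3 * \<theta>)) * ln (w \<theta>)) \<le> ennreal (2 * w \<theta>)"
        by (intro ennreal_leI weighted_ln_le) auto
      then show ?thesis using False by (simp add: elog_def ennreal_mult)
    qed
  qed
  also have "\<dots> = 2 * (\<integral>\<^sup>+\<theta>. ennreal (w \<theta>) \<partial>angle_measure)" by (intro nn_integral_cmult) simp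
  also have "\<dots> \<le> 2 * 1" by (intro mult_left_mono emeasure_parts_le_1) simp
  finally have "?p < \<infinity>" by (auto simp: less_top[symmetric] top_unique)
  then obtain p where p: "?p = ennreal p" "0 \<le> p" by (cases ?p) auto
  have eq: "szego_integral w = enn2ereal ?p - enn2ereal (szego_neg_integral w)"
    by (simp add: szego_integral_def ereal_integral_def szego_neg_integral_def)
  show ?thesis
    unfolding eq p(1) using p(2) by (cases "szego_neg_integral w") auto
qed

text \<open>The bound is explicit and uniform in n: minus the n-th integral is at most 2 plus the
  negative part for w.\<close>

lemma szego_neg_integral_finite_imp:
  assumes "szego_neg_integral w < \<infinity>"
  shows "\<exists>C. \<forall>n. - C \<le> bs_log_integral (verblunsky \<mu>) n"
proof (intro exI allI)
  fix n
  note [measurable] = w_measurable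
  let ?\<alpha> = "verblunsky \<mu>"
  let ?b = "bs_weight ?\<alpha> n"
  note a = verblunsky_norm(1)[OF mu]
  note bp = bs_weight_pos[of ?\<alpha>, OF a] and bc = continuous_on_bs_weight[of ?\<alpha>, OF a]
  define f where "f \<theta> = - ((1 - cos (3 * \<theta>)) * ln (?b (cis \<theta>)))" for \<theta>
  have fi: "integrable angle_measure f"
    unfolding f_def by (intro integrable_minus integrable_weighted_ln[OF bc bp])
  have bi: "(\<lambda>z. ennreal (1 / ?b z)) \<in> borel_measurable circle_borel"
  proof -
    have "continuous_on (sphere 0 1) (\<lambda>z. 1 / ?b z)"
      using bp[of _ n] by (intro continuous_intros bc ballI) (metis less_irrefl mem_sphere_0)
    from continuous_on_imp_measurable_circle[OF this] show ?thesis by measurable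
  qed
  have "ennreal (- bs_log_integral ?\<alpha> n) = ennreal (integral\<^sup>L angle_measure f)"
    by (simp add: f_def[abs_def] bs_log_integral_def)
  also have "\<dots> \<le> ennreal (\<integral>\<theta>. max 0 (f \<theta>) \<partial>angle_measure)"
    using fi by (intro ennreal_leI integral_mono) auto
  also have "\<dots> = (\<integral>\<^sup>+\<theta>. ennreal (max 0 (f \<theta>)) \<partial>angle_measure)"
    using fi by (intro nn_integral_eq_integral[symmetric]) auto
  \<comment> \<open>With g the weight and b the approximating density, -g ln b = g ln (w / b) - g ln
    w, and \<open>weighted_ln_le\<close> bounds the first term by 2 w / b. Values in
    [0, \<infinity>] make the inequality trivial where w = 0 and g > 0.\<close>
  also have "\<dots> \<le> (\<integral>\<^sup>+\<theta>. 2 * (ennreal (w \<theta>) * ennreal (1 / ?b (cis \<theta>))) + e2ennreal (- (ereal (1 - cos (3 * \<theta>)) * elog (w \<theta>))) \<partial>angle_measure)"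
  proof (intro nn_integral_mono)
    fix \<theta>
    let ?g = "1 - cos (3 * \<theta>)" and ?z = "cis \<theta>"
    have g0: "0 \<le> ?g" by (rule one_minus_cos_bounds)
    have b: "0 < ?b ?z" by (rule bp) simp
    show "ennreal (max 0 (f \<theta>)) \<le> 2 * (ennreal (w \<theta>) * ennreal (1 / ?b ?z)) + e2ennreal (- (ereal ?g * elog (w \<theta>)))"
    proof (cases "w \<theta> \<le> 0")
      case True
      show ?thesis
      proof (cases "?g = 0")
        case True
        then show ?thesis by (simp add: f_def)
      next
        case False
        with g0 have "0 < ?g" by linarith
        then have "- (ereal ?g * elog (w \<theta>)) = \<infinity>" using True by (simp add: elog_def)
        then show ?thesis by simp
      qed
    next
      case False
      then have w0: "0 < w \<theta>" by simp
      have "?g * ln (w \<theta> / ?b ?z) \<le> 2 * (w \<theta> / ?b ?z)" using w0 b by (intro weighted_ln_le) simp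
      then have "f \<theta> \<le> 2 * (w \<theta> / ?b ?z) + - (?g * ln (w \<theta>))"
        using w0 b by (simp add: f_def ln_div algebra_simps)
      then have "max 0 (f \<theta>) \<le> 2 * (w \<theta> * (1 / ?b ?z)) + max 0 (- (?g * ln (w \<theta>)))"
        using w0 b by (auto simp: max_def)
      then have "ennreal (max 0 (f \<theta>)) \<le> ennreal (2 * (w \<theta> * (1 / ?b ?z)) + max 0 (- (?g * ln (w \<theta>))))"
        by (rule ennreal_leI)
      also have "\<dots> = ennreal (2 * (w \<theta> * (1 / ?b ?z))) + ennreal (max 0 (- (?g * ln (w \<theta>))))"
        using w0 b by (intro ennreal_plus) auto
      also have "ennreal (2 * (w \<theta> * (1 / ?b ?z))) = 2 * (ennreal (w \<theta>) * ennreal (1 / ?b ?z))"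
        using w0 b by (simp add: ennreal_mult del: times_divide_eq_right)
      also have "ennreal (max 0 (- (?g * ln (w \<theta>)))) = e2ennreal (- (ereal ?g * elog (w \<theta>)))"
        using w0 by (simp add: elog_def max_def ennreal_neg)
      finally show ?thesis .
    qed
  qed
  also have "\<dots> = (\<integral>\<^sup>+\<theta>. 2 * (ennreal (w \<theta>) * ennreal (1 / ?b (cis \<theta>))) \<partial>angle_measure) + szego_neg_integral w"
    unfolding szego_neg_integral_def elog_def using measurable_compose[OF cis_measurable bi]
    by (intro nn_integral_add) (auto intro!: measurable_If)
  also have "(\<integral>\<^sup>+\<theta>. 2 * (ennreal (w \<theta>) * ennreal (1 / ?b (cis \<theta>))) \<partial>angle_measure)
      = 2 * (\<integral>\<^sup>+\<theta>. ennreal (w \<theta>) * ennreal (1 / ?b (cis \<theta>)) \<partial>angle_measure)"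
    using measurable_compose[OF cis_measurable bi] by (intro nn_integral_cmult) auto
  also have "(\<integral>\<^sup>+\<theta>. ennreal (w \<theta>) * ennreal (1 / ?b (cis \<theta>)) \<partial>angle_measure) \<le> (\<integral>\<^sup>+z. ennreal (1 / ?b z) \<partial>\<mu>)"
    unfolding nn_integral_decomposition[OF bi] by simp
  also have "(\<integral>\<^sup>+z. ennreal (1 / ?b z) \<partial>\<mu>) = 1"
  proof -
    \<comment> \<open>The reciprocal density is the squared modulus of the orthonormal
      polynomial.\<close>
    let ?P = "szego_poly ?\<alpha> n" and ?h = "szego_norm ?\<alpha> n"
    have h: "0 < ?h" by (rule szego_norm_pos[of ?\<alpha>, OF a])
    note fm = finite_measure_circle[OF mu]
    have "(\<integral>\<^sup>+z. ennreal (1 / ?b z) \<partial>\<mu>) = (\<integral>\<^sup>+z. ennreal ((norm (poly ?P z))\<^sup>2 / ?h) \<partial>\<mu>)"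
      by (intro nn_integral_cong) (simp add: bs_weight_def fm(3) norm_szego_on_circle)
    also have "\<dots> = ennreal (\<integral>z. (norm (poly ?P z))\<^sup>2 / ?h \<partial>\<mu>)"
      using h by (intro nn_integral_eq_integral integrable_circle[OF fm(1,2)] continuous_intros) auto
    also have "\<dots> = 1" using verblunsky_norm(2)[OF mu, of n] h by simp
    finally show ?thesis .
  qed
  finally have "ennreal (- bs_log_integral ?\<alpha> n) \<le> 2 + szego_neg_integral w"
    by (simp add: mult_left_mono add_mono)
  then have "- bs_log_integral ?\<alpha> n \<le> enn2real (2 + szego_neg_integral w)"
    using assms by (cases "szego_neg_integral w") (auto simp: ennreal_le_iff2 simp flip: ennreal_plus ennreal_numeral)
  then show "- enn2real (2 + szego_neg_integral w) \<le> bs_log_integral ?\<alpha> n" by simp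
qed

end

text \<open>The bound C + 6 does not depend on the truncation level, so it survives the limit by
  monotone convergence.\<close>

lemma szego_neg_integral_finite_if:
  assumes mu: "nontrivial_circle_prob \<mu>" and dec: "lebesgue_decomposition \<mu> w \<mu>s"
    and C: "\<And>n. - C \<le> bs_log_integral (verblunsky \<mu>) n"
  shows "szego_neg_integral w < \<infinity>"
proof -
  interpret A: prob_space angle_measure by (rule prob_space_angle_measure)
  interpret M: prob_space \<mu> by (rule nontrivial_circle_probD(1)[OF mu])
  note [measurable] = w_measurable[OF mu dec]
  have ss: "sets \<mu>s = sets circle_borel" and sing: "mutually_singular \<mu>s arc_length"
    using dec by (auto simp: lebesgue_decomposition_def)
  have sps: "space \<mu>s = sphere 0 1" using sets_eq_imp_space_eq[OF ss] by simp
  obtain A where A: "A \<in> sets circle_borel" "emeasure \<mu>s A = 0" "emeasure arc_length (sphere 0 1 - A) = 0"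
    using sing ss by (auto simp: mutually_singular_def)
  have [measurable]: "A \<in> sets borel"
    using A(1) by (auto simp: circle_borel_def sets_restrict_space_iff)
  have cis[measurable]: "cis \<in> borel_measurable borel" by (intro borel_measurable_continuous_onI continuous_intros)
  have AEA: "AE \<theta> in angle_measure. cis \<theta> \<in> A"
  proof -
    have "AE z in arc_length. z \<in> A"
      using A(1,3) by (intro AE_I[of _ _ "sphere 0 1 - A"]) (auto simp flip: space_circle_borel)
    then show ?thesis unfolding arc_length_def by (rule AE_distrD[OF cis_measurable])
  qed
  \<comment> \<open>Truncations of the negative part, increasing in k; their supremum dominates the
    integrand also where w = 0.\<close>
  define h where "h k \<theta> = (1 - cos (3 * \<theta>)) * max 0 (- ln (max (w \<theta>) (1 / real (Suc k))))" for k \<theta>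
  have hm [measurable]: "h k \<in> borel_measurable borel" for k unfolding h_def by measurable
  have bound: "(\<integral>\<^sup>+\<theta>. ennreal (h k \<theta>) \<partial>angle_measure) \<le> ennreal (C + 6)" for k
  proof -
    define K where "K = real (Suc k)"
    have K: "1 \<le> K" by (simp add: K_def)
    \<comment> \<open>\<open>1 / w\<close> clipped to \<open>[1, K]\<close>, and \<open>1\<close> on the null set carrying \<open>\<mu>\<^sub>s\<close>; avoids dividing by \<open>w = 0\<close>.\<close>
    define F where "F z = (if z \<in> A then max 1 (1 / max (w (Arg2pi z)) (1 / K)) else 1)" for z
    have F[measurable]: "F \<in> borel_measurable borel" unfolding F_def by measurable
    have F1: "1 \<le> F z" for z by (simp add: F_def)
    have mK: "1 / K \<le> max x (1 / K)" "0 < max x (1 / K)" for x using K by (auto simp: less_max_iff_disj)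
    have FK: "F z \<le> K" for z
    proof -
      have "1 / max (w (Arg2pi z)) (1 / K) \<le> 1 / (1 / K)"
        using mK[of "w (Arg2pi z)"] K by (intro divide_left_mono mult_pos_pos) auto
      then show ?thesis using K by (simp add: F_def)
    qed
    have "(\<integral>\<^sup>+z. ennreal (F z) \<partial>\<mu>) = (\<integral>\<^sup>+\<theta>. ennreal (w \<theta>) * ennreal (F (cis \<theta>)) \<partial>angle_measure) + (\<integral>\<^sup>+z. ennreal (F z) \<partial>\<mu>s)"
      by (intro nn_integral_decomposition[OF mu dec]) (intro borel_measurable_circle, measurable)
    \<comment> \<open>The absolutely continuous part sees w F \<le> w + 1, of integral at most 2;
      the singular part sees F = 1 and has mass at most 1.\<close>
    also have "\<dots> \<le> 2 + 1"
    proof (intro add_mono)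
      have "(\<integral>\<^sup>+\<theta>. ennreal (w \<theta>) * ennreal (F (cis \<theta>)) \<partial>angle_measure) \<le> (\<integral>\<^sup>+\<theta>. ennreal (w \<theta>) + 1 \<partial>angle_measure)"
      proof (intro nn_integral_mono_AE)
        show "AE \<theta> in angle_measure. ennreal (w \<theta>) * ennreal (F (cis \<theta>)) \<le> ennreal (w \<theta>) + 1"
          using AE_angle_measure AE_w_nonneg[OF mu dec]
        proof eventually_elim
          case (elim \<theta>)
          have "w \<theta> * F (cis \<theta>) \<le> w \<theta> + 1"
          proof (cases "cis \<theta> \<in> A")
            case True
            then have "F (cis \<theta>) = max 1 (1 / max (w \<theta>) (1 / K))" using elim by (simp add: F_def Arg2pi_cis)
            moreover have "w \<theta> * (1 / max (w \<theta>) (1 / K)) \<le> 1" using mK(2)[of "w \<theta>"] by (simp add: divide_le_eq)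
            ultimately show ?thesis using elim by (auto simp: max_def)
          qed (simp add: F_def)
          then have "ennreal (w \<theta> * F (cis \<theta>)) \<le> ennreal (w \<theta> + 1)" by (rule ennreal_leI)
          then show ?case using elim order_trans[OF zero_le_one F1] by (simp add: ennreal_mult)
        qed
      qed
      also have "\<dots> = (\<integral>\<^sup>+\<theta>. ennreal (w \<theta>) \<partial>angle_measure) + 1"
      proof -
        have "(\<lambda>\<theta>. ennreal (w \<theta>)) \<in> borel_measurable angle_measure" by measurable
        then show ?thesis using A.emeasure_space_1 by (subst nn_integral_add) auto
      qed
      also have "\<dots> \<le> 1 + 1" by (intro add_mono emeasure_parts_le_1[OF mu dec]) simp
      finally show "(\<integral>\<^sup>+\<theta>. ennreal (w \<theta>) * ennreal (F (cis \<theta>)) \<partial>angle_measure) \<le> 2" by simp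
      have "A \<in> null_sets \<mu>s" using A ss by (auto simp: null_sets_def)
      then have "AE z in \<mu>s. z \<notin> A" by (rule AE_not_in)
      then have "(\<integral>\<^sup>+z. ennreal (F z) \<partial>\<mu>s) = (\<integral>\<^sup>+z. 1 \<partial>\<mu>s)"
        by (intro nn_integral_cong_AE) (auto simp: F_def elim!: eventually_mono)
      then show "(\<integral>\<^sup>+z. ennreal (F z) \<partial>\<mu>s) \<le> 1" using emeasure_parts_le_1[OF mu dec] by simp
    qed
    also have "(2::ennreal) + 1 = ennreal 3" by simp
    finally have F3': "(\<integral>\<^sup>+z. ennreal (F z) \<partial>\<mu>) \<le> ennreal 3" .
    have Fi: "integrable \<mu> F"
      using measurable_compose[OF measurable_ident_circle[OF nontrivial_circle_probD(2)[OF mu]] F] FK order_trans[OF zero_le_one F1]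
      by (intro M.integrable_const_bound[where B = K]) auto
    have "ennreal (\<integral>z. F z \<partial>\<mu>) \<le> ennreal 3"
      using F3' Fi order_trans[OF zero_le_one F1] by (subst nn_integral_eq_integral[symmetric]) auto
    then have F3: "(\<integral>z. F z \<partial>\<mu>) \<le> 3" by (subst (asm) ennreal_le_iff) auto
    let ?f = "\<lambda>\<theta>. (1 - cos (3 * \<theta>)) * ln (F (cis \<theta>))"
    have lnF: "0 \<le> ?f \<theta>" "?f \<theta> \<le> 2 * ln K" for \<theta>
      using F1[of "cis \<theta>"] FK[of "cis \<theta>"] by (intro mult_mono mult_nonneg_nonneg one_minus_cos_bounds; simp)+
    have "integrable angle_measure ?f"
      using lnF by (intro A.integrable_const_bound[where B = "2 * ln K"]) auto
    then have "(\<integral>\<^sup>+\<theta>. ennreal (?f \<theta>) \<partial>angle_measure) = ennreal (\<integral>\<theta>. ?f \<theta> \<partial>angle_measure)"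
      using lnF by (intro nn_integral_eq_integral) auto
    \<comment> \<open>6 is twice the bound 3 for the integral of F.\<close>
    also have "\<dots> \<le> ennreal (C + 6)"
      using weighted_ln_integral_le_borel[OF mu C F F1 FK] F3 by (intro ennreal_leI) auto
    finally have "(\<integral>\<^sup>+\<theta>. ennreal (?f \<theta>) \<partial>angle_measure) \<le> ennreal (C + 6)" .
    moreover have "(\<integral>\<^sup>+\<theta>. ennreal (h k \<theta>) \<partial>angle_measure) = (\<integral>\<^sup>+\<theta>. ennreal (?f \<theta>) \<partial>angle_measure)"
    proof (intro nn_integral_cong_AE)
      show "AE \<theta> in angle_measure. ennreal (h k \<theta>) = ennreal (?f \<theta>)"
        using AE_angle_measure AEA
      proof eventually_elim
        case (elim \<theta>)
        let ?m = "max (w \<theta>) (1 / K)"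
        have "ln (max 1 (1 / ?m)) = max 0 (- ln ?m)"
        proof -
          have "ln (1 / ?m) = - ln ?m" using mK(2)[of "w \<theta>"] by (simp add: ln_div)
          moreover have "1 \<le> 1 / ?m \<longleftrightarrow> 0 \<le> ln (1 / ?m)" using mK(2)[of "w \<theta>"] by (intro ln_ge_zero_iff[symmetric]) simp
          ultimately show ?thesis by (cases "1 \<le> 1 / ?m") (auto simp: max_def)
        qed
        then show ?case using elim by (simp add: h_def F_def Arg2pi_cis K_def)
      qed
    qed
    ultimately show ?thesis by simp
  qed
  have inc: "incseq (\<lambda>k \<theta>. ennreal (h k \<theta>))"
  proof (intro incseq_SucI le_funI ennreal_leI)
    fix k \<theta>
    have "1 / real (Suc (Suc k)) \<le> 1 / real (Suc k)" by (simp add: frac_le)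
    then have "max (w \<theta>) (1 / real (Suc (Suc k))) \<le> max (w \<theta>) (1 / real (Suc k))" by (rule max.mono[OF order_refl])
    then have "ln (max (w \<theta>) (1 / real (Suc (Suc k)))) \<le> ln (max (w \<theta>) (1 / real (Suc k)))"
      by (subst ln_le_cancel_iff) (auto simp: less_max_iff_disj)
    then show "h k \<theta> \<le> h (Suc k) \<theta>"
      unfolding h_def by (intro mult_left_mono one_minus_cos_bounds max.mono) auto
  qed
  have "szego_neg_integral w \<le> (\<integral>\<^sup>+\<theta>. (SUP k. ennreal (h k \<theta>)) \<partial>angle_measure)"
    unfolding szego_neg_integral_def
  proof (intro nn_integral_mono)
    fix \<theta> :: real
    let ?g = "1 - cos (3 * \<theta>)"
    have g0: "0 \<le> ?g" by (rule one_minus_cos_bounds)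
    show "e2ennreal (- (ereal ?g * elog (w \<theta>))) \<le> (SUP k. ennreal (h k \<theta>))"
    proof (cases "w \<theta> \<le> 0")
      case True
      show ?thesis
      proof (cases "?g = 0")
        case True
        then show ?thesis by (simp flip: zero_ereal_def)
      next
        case False
        with g0 have g: "0 < ?g" by linarith
        have "(SUP k. ennreal (h k \<theta>)) = top"
          unfolding SUP_eq_top_iff
        proof (intro allI impI)
          fix x :: ennreal assume "x < top"
          then obtain r where r: "x = ennreal r" "0 \<le> r" by (cases x) auto
          \<comment> \<open>Where w \<le> 0 the truncation is ?g ln (k + 1), which must exceed
            r.\<close>
          obtain k :: nat where k: "exp (r / ?g + 1) < real k" using reals_Archimedean2 by blast
          have "r / ?g + 1 = ln (exp (r / ?g + 1))" by simp
          also have "\<dots> \<le> ln (real (Suc k))" using k by (intro ln_mono) auto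
          finally have "r / ?g < ln (real (Suc k))" by simp
          then have "r < ?g * ln (real (Suc k))" using g by (simp add: pos_divide_less_eq mult.commute)
          moreover have "h k \<theta> = ?g * ln (real (Suc k))"
          proof -
            have "max (w \<theta>) (1 / real (Suc k)) = 1 / real (Suc k)"
              using True by (intro max_absorb2) (auto intro: order_trans)
            then show ?thesis unfolding h_def by (simp add: ln_div del: of_nat_Suc) 
          qed
          ultimately show "\<exists>k\<in>UNIV. x < ennreal (h k \<theta>)"
            using r by (intro bexI[of _ k]) (auto simp: ennreal_less_iff)
        qed
        then show ?thesis by (simp only: top_greatest)
      qed
    next
      case False
      then obtain k :: nat where "1 / w \<theta> < real k" using reals_Archimedean2 by blast
      then have "1 / real (Suc k) \<le> w \<theta>" using False by (simp add: field_simps)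
      then have "max (w \<theta>) (1 / real (Suc k)) = w \<theta>" by (rule max_absorb1)
      then have "?g * - ln (w \<theta>) \<le> h k \<theta>"
        unfolding h_def using g0 by (intro mult_left_mono) auto
      then have "ennreal (?g * - ln (w \<theta>)) \<le> ennreal (h k \<theta>)" by (rule ennreal_leI)
      moreover have "e2ennreal (- (ereal ?g * elog (w \<theta>))) = ennreal (?g * - ln (w \<theta>))"
        using False by (simp add: elog_def)
      ultimately show ?thesis by (intro SUP_upper2[of k]) auto
    qed
  qed
  also have "\<dots> = (SUP k. \<integral>\<^sup>+\<theta>. ennreal (h k \<theta>) \<partial>angle_measure)"
    by (intro nn_integral_monotone_convergence_SUP inc) auto
  also have "\<dots> \<le> ennreal (C + 6)" by (intro SUP_least bound)
  also have "\<dots> < \<infinity>" by simp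
  finally show ?thesis .
qed

lemma bs_log_integral_Suc:
  assumes a: "\<And>n. norm (\<alpha> n) < 1"
  shows "bs_log_integral \<alpha> (n + 4) - bs_log_integral \<alpha> (n + 3) =
    ln (1 - (norm (\<alpha> (n + 3)))\<^sup>2) + Re (step_poly (\<alpha> n) (\<alpha> (n + 1)) (\<alpha> (n + 2)) (\<alpha> (n + 3)))"
proof -
  have "szego_norm \<alpha> (n + 4) = szego_norm \<alpha> (n + 3) * (1 - (norm (\<alpha> (n + 3)))\<^sup>2)"
  proof -
    have n4: "n + 4 = Suc (n + 3)" by simp
    show ?thesis unfolding n4 szego_norm_def by (rule prod.lessThan_Suc)
  qed
  moreover have "0 < 1 - (norm (\<alpha> (n + 3)))\<^sup>2" using a[of "n + 3"] by (simp add: abs_square_less_1)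
  ultimately have "ln (szego_norm \<alpha> (n + 4)) = ln (szego_norm \<alpha> (n + 3)) + ln (1 - (norm (\<alpha> (n + 3)))\<^sup>2)"
    using szego_norm_pos[of \<alpha>, OF a] by (simp only: ln_mult_pos)
  moreover have "Re (log_coeff3 (szego_rev \<alpha> (n + 4))) - Re (log_coeff3 (szego_rev \<alpha> (n + 3)))
      = Re (step_poly (\<alpha> n) (\<alpha> (n + 1)) (\<alpha> (n + 2)) (\<alpha> (n + 3)))"
    unfolding step_poly_def log_coeff3_step[symmetric] by (rule minus_complex.simps(1)[symmetric])
  ultimately show ?thesis unfolding bs_log_integral_eq[of \<alpha>, OF a] by linarith
qed

theorem theorem4p14:
  fixes \<mu> \<mu>s :: "complex measure" and w :: "real \<Rightarrow> real" and \<alpha> :: "nat \<Rightarrow> complex"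
  assumes "nontrivial_circle_prob \<mu>"
    and "lebesgue_decomposition \<mu> w \<mu>s"
    and "\<alpha> = verblunsky \<mu>"
    and "(\<lambda>n. left_shift \<alpha> n - \<alpha> n) \<in> ell 2"
  shows "szego_integral w > - \<infinity> \<longleftrightarrow> \<alpha> \<in> ell 4"
proof -
  note mu = assms(1) and dec = assms(2)
  have a: "norm (\<alpha> n) < 1" for n unfolding assms(3) by (rule verblunsky_norm(1)[OF mu])
  have d: "summable (\<lambda>n. (norm (\<alpha> (Suc n) - \<alpha> n))\<^sup>2)"
    using assms(4) by (simp add: ell_def left_shift_def)
  define t where "t n = ln (1 - (norm (\<alpha> (n + 3)))\<^sup>2) + Re (step_poly (\<alpha> n) (\<alpha> (n + 1)) (\<alpha> (n + 2)) (\<alpha> (n + 3)))" for n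
  let ?Z = "bs_log_integral \<alpha>"
  have Z: "?Z (n + 3) = ?Z 3 + (\<Sum>j<n. t j)" for n
  proof (induction n)
    case (Suc n)
    then show ?case using bs_log_integral_Suc[of \<alpha> n, OF a] by (simp add: t_def eval_nat_numeral)
  qed simp
  have "szego_integral w > - \<infinity> \<longleftrightarrow> szego_neg_integral w < \<infinity>"
    by (rule szego_integral_gt_iff[OF mu dec])
  also have "\<dots> \<longleftrightarrow> (\<exists>C. \<forall>n. - C \<le> ?Z n)"
    using szego_neg_integral_finite_imp[OF mu dec] szego_neg_integral_finite_if[OF mu dec] unfolding assms(3) by blast
  also have "\<dots> \<longleftrightarrow> (\<exists>B. \<forall>n. B \<le> (\<Sum>j<n. t j))"
  proof
    assume "\<exists>C. \<forall>n. - C \<le> ?Z n"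
    then obtain C where C: "\<And>n. - C \<le> ?Z n" by blast
    have "- C - ?Z 3 \<le> (\<Sum>j<n. t j)" for n using C[of "n + 3"] unfolding Z by simp
    then show "\<exists>B. \<forall>n. B \<le> (\<Sum>j<n. t j)" by blast
  next
    assume "\<exists>B. \<forall>n. B \<le> (\<Sum>j<n. t j)"
    then obtain B where B: "\<And>n. B \<le> (\<Sum>j<n. t j)" by blast
    \<comment> \<open>The increments are known only from index 3 on, so the first three values are
      bounded separately.\<close>
    have "min (min (?Z 0) (?Z 1)) (min (?Z 2) (?Z 3 + B)) \<le> ?Z n" for n
    proof (cases "n < 3")
      case True
      then have "n = 0 \<or> n = 1 \<or> n = 2" by auto
      then show ?thesis by auto
    next
      case False
      then have "n = (n - 3) + 3" by simp
      then have "?Z n = ?Z 3 + (\<Sum>j<n - 3. t j)" using Z by metis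
      then show ?thesis using B[of "n - 3"] by simp
    qed
    then show "\<exists>C. \<forall>n. - C \<le> ?Z n" by (metis minus_minus)
  qed
  also have "\<dots> \<longleftrightarrow> summable (\<lambda>n. norm (\<alpha> n) ^ 4)"
    unfolding t_def by (rule bounded_step_sums_iff_ell4[OF a d])
  finally show ?thesis by (simp add: ell_def)
qed

end
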